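(* Let $G_1,\ldots,G_s$ be finite, undirected, simple graphs with node sets $N_1,\ldots,N_s$, such that for a fixed set $N_0$ (contained in every $N_i$) we have $N_i\cap N_k=N_0$ for all $i\neq k$ in $[s]$, and such that the graph induced on $N_0$ by each $G_i$ equals a fixed graph $H$. For each $j\in\bigcup_i N_i$ fix a number $d_j$ of states. Then there exists $D\in\mathbb{Z}_{\geq 0}$ such that for all multiplicities $a_1,\ldots,a_s\in\mathbb{Z}_{\geq 0}$, the ideal $I_G$ of the glued graph $G=\sum_H^{a_1}G_1+_H\cdots+_H\sum_H^{a_s}G_s$ is generated by binomials of degree at most $D$.
   Context: Notation: $[d]=\{1,\ldots,d\}$; the numbers of states $d_j$ are positive integers. A binomial is a difference of two monomials. Glueing: $G=\sum_H^{a_1}G_1+_H\cdots+_H\sum_H^{a_s}G_s$ is the graph obtained by taking $a_i$ disjoint copies of $G_i$ for each $i\in[s]$ and then, for each $j\in N_0$, identifying the nodes labelled by $j$ across all copies. So the node set of $G$ is the disjoint union of $N_0$ and, for each $i\in[s]$, $a_i$ copies of $N_i\setminus N_0$ (if all $a_i=0$ this is read as $G=H$). Each copy of a node $j$ has the same number $d_j$ of states as $j$. Ideal of a graph: for a finite simple graph $G=(N,E)$ with a number $d_j$ of states for each $j\in N$, let $\mathrm{mcl}(G)$ be the set of maximal cliques of $G$. Define $$\varphi_G:\mathbb{C}^{\prod_{C\in \mathrm{mcl}(G)}\prod_{j\in C}[d_j]}\to\mathbb{C}^{\prod_{j\in N}[d_j]},\qquad (\theta^C_\alpha)_{C,\alpha}\mapsto\Big(\prod_{C\in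 \mathrm{mcl}(G)}\theta^C_{\beta|_C}\Big)_{\beta},$$ where the domain has one coordinate $\theta^C_\alpha$ for each pair of a $C\in \mathrm{mcl}(G)$ and an $\alpha\in\prod_{j\in C}[d_j]$, $\beta$ runs over $\prod_{j\in N}[d_j]$, and $\beta|_C$ is the restriction of $\beta$ to $C$. The ideal $I_G$ is the ideal of all polynomials over $\mathbb{C}$ in the standard coordinates on $\mathbb{C}^{\prod_{j\in N}[d_j]}$ that vanish on the image of $\varphi_G$. *)

theory Defs
  imports Complex_Main "HOL-Library.Poly_Mapping" "HOL-Library.FuncSet" "HOL-Algebra.Ideal"
begin

section \<open>Finite simple graphs and maximal cliques\<close>

record 'v ugraph =
  verts :: "'v set"
  edges :: "'v set set"

definition simple_graph :: "'v ugraph \<Rightarrow> bool" where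
  "simple_graph G \<longleftrightarrow> finite (verts G) \<and> (\<forall>e\<in>edges G. e \<subseteq> verts G \<and> card e = 2)"

definition induced_subgraph :: "'v ugraph \<Rightarrow> 'v set \<Rightarrow> 'v ugraph" where
  "induced_subgraph G S = \<lparr>verts = S, edges = {e \<in> edges G. e \<subseteq> S}\<rparr>"

definition clique :: "'v ugraph \<Rightarrow> 'v set \<Rightarrow> bool" where
  "clique G C \<longleftrightarrow> C \<subseteq> verts G \<and> (\<forall>u\<in>C. \<forall>v\<in>C. u \<noteq> v \<longrightarrow> {u, v} \<in> edges G)"

text \<open>The empty set is a clique, so the graph without nodes has exactly one maximal clique.\<close>

definition mcl :: "'v ugraph \<Rightarrow> 'v set set" where
  "mcl G = {C. clique G C \<and> (\<forall>C'. clique G C' \<longrightarrow> C \<subseteq> C' \<longrightarrow> C' = C)}"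


section \<open>Glueing\<close>

text \<open>\<open>Shared j\<close> is the single node labelled by \<open>j \<in> N\<^sub>0\<close> after the identification;
  \<open>Copy i k j\<close> is the node labelled by \<open>j \<in> N\<^sub>i - N\<^sub>0\<close> in the \<open>k\<close>-th copy of \<open>G\<^sub>i\<close>.\<close>

datatype 'v gnode = Shared (label: 'v) | Copy nat nat (label: 'v)

definition embed_copy :: "'v set \<Rightarrow> nat \<Rightarrow> nat \<Rightarrow> 'v \<Rightarrow> 'v gnode" where
  "embed_copy N0 i k j = (if j \<in> N0 then Shared j else Copy i k j)"

text \<open>\<open>glue H s G a\<close> is the glueing of \<open>a i\<close> copies of each \<open>G i\<close>, \<open>1 \<le> i \<le> s\<close>, along \<open>H\<close>.
  The contribution of \<open>H\<close> itself only matters when all \<open>a i\<close> vanish.\<close>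

definition glue :: "'v ugraph \<Rightarrow> nat \<Rightarrow> (nat \<Rightarrow> 'v ugraph) \<Rightarrow> (nat \<Rightarrow> nat) \<Rightarrow> 'v gnode ugraph" where
  "glue H s G a =
    \<lparr>verts = Shared ` verts H \<union>
       (\<Union>i\<in>{1..s}. \<Union>k\<in>{1..a i}. embed_copy (verts H) i k ` verts (G i)),
     edges = image Shared ` edges H \<union>
       (\<Union>i\<in>{1..s}. \<Union>k\<in>{1..a i}. image (embed_copy (verts H) i k) ` edges (G i))\<rparr>"


section \<open>Polynomials in a given set of indeterminates\<close>

type_synonym 'x cpoly = "('x \<Rightarrow>\<^sub>0 nat) \<Rightarrow>\<^sub>0 complex"

definition indets :: "'x cpoly \<Rightarrow> 'x set" where
  "indets p = (\<Union>m\<in>Poly_Mapping.keys p. Poly_Mapping.keys m)"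

definition eval_poly :: "('x \<Rightarrow> complex) \<Rightarrow> 'x cpoly \<Rightarrow> complex" where
  "eval_poly x p = (\<Sum>m\<in>Poly_Mapping.keys p. Poly_Mapping.lookup p m * (\<Prod>i\<in>Poly_Mapping.keys m. x i ^ Poly_Mapping.lookup m i))"

definition total_degree :: "'x cpoly \<Rightarrow> nat" where
  "total_degree p = Max (insert 0 ((\<lambda>m. \<Sum>i\<in>Poly_Mapping.keys m. Poly_Mapping.lookup m i) ` Poly_Mapping.keys p))"

definition is_binomial :: "'x cpoly \<Rightarrow> bool" where
  "is_binomial p \<longleftrightarrow> (\<exists>m n. p = Poly_Mapping.single m 1 - Poly_Mapping.single n 1)"

definition poly_ring :: "'x set \<Rightarrow> 'x cpoly ring" where
  "poly_ring X = \<lparr>carrier = {p. indets p \<subseteq> X}, mult = (*), one = 1, zero = 0, add = (+)\<rparr>"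

lemma poly_ring_cring: "cring (poly_ring X)"
proof -
  have add: "indets (p + q) \<subseteq> X" if "indets p \<subseteq> X" "indets q \<subseteq> X" for p q :: "'a cpoly"
    using that Poly_Mapping.keys_add[of p q] unfolding indets_def by blast
  have neg: "indets (- p) \<subseteq> X" if "indets p \<subseteq> X" for p :: "'a cpoly"
    using that by (simp add: indets_def)
  have mult: "indets (p * q) \<subseteq> X" if "indets p \<subseteq> X" "indets q \<subseteq> X" for p q :: "'a cpoly"
  proof
    fix i assume "i \<in> indets (p * q)"
    then obtain m where "m \<in> Poly_Mapping.keys (p * q)" "i \<in> Poly_Mapping.keys m" by (auto simp: indets_def)
    with Poly_Mapping.keys_mult[of p q] obtain u v where "m = u + v" "u \<in> Poly_Mapping.keys p" "v \<in> Poly_Mapping.keys q" by blast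
    with \<open>i \<in> Poly_Mapping.keys m\<close> Poly_Mapping.keys_add[of u v] that show "i \<in> X"
      unfolding indets_def by blast
  qed
  have abelian: "abelian_group (poly_ring X)"
  proof (rule abelian_groupI)
    fix p assume "p \<in> carrier (poly_ring X)"
    then show "\<exists>q\<in>carrier (poly_ring X). q \<oplus>\<^bsub>poly_ring X\<^esub> p = \<zero>\<^bsub>poly_ring X\<^esub>"
      by (intro bexI[of _ "- p"]) (auto simp: poly_ring_def neg)
  qed (auto simp: poly_ring_def add algebra_simps indets_def[of 0])
  have monoid: "comm_monoid (poly_ring X)"
    by (rule comm_monoidI)
       (auto simp: poly_ring_def mult algebra_simps indets_def[of 1])
  show ?thesis
    by (rule cringI[OF abelian monoid]) (simp add: poly_ring_def algebra_simps)
qed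


section \<open>The ideal of a graph\<close>

text \<open>The product \<open>\<Prod>\<^bsub>j\<in>C\<^esub> [d\<^sub>j]\<close>.\<close>

definition states :: "('v \<Rightarrow> nat) \<Rightarrow> 'v set \<Rightarrow> ('v \<Rightarrow> nat) set" where
  "states d C = (\<Pi>\<^sub>E j\<in>C. {1..d j})"

text \<open>For a finite index set \<open>J\<close>, the space \<open>\<complex>\<^sup>J\<close> is rendered as \<open>J \<rightarrow>\<^sub>E UNIV\<close>.\<close>

definition param_space :: "'v ugraph \<Rightarrow> ('v \<Rightarrow> nat) \<Rightarrow> ('v set \<times> ('v \<Rightarrow> nat) \<Rightarrow> complex) set" where
  "param_space G d = ((SIGMA C:mcl G. states d C) \<rightarrow>\<^sub>E UNIV)"

definition param_map ::
  "'v ugraph \<Rightarrow> ('v \<Rightarrow> nat) \<Rightarrow> ('v set \<times> ('v \<Rightarrow> nat) \<Rightarrow> complex) \<Rightarrow> (('v \<Rightarrow> nat) \<Rightarrow> complex)" where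
  "param_map G d \<theta> = (\<lambda>\<beta>\<in>states d (verts G). \<Prod>C\<in>mcl G. \<theta> (C, restrict \<beta> C))"

definition graph_poly_ring :: "'v ugraph \<Rightarrow> ('v \<Rightarrow> nat) \<Rightarrow> ('v \<Rightarrow> nat) cpoly ring" where
  "graph_poly_ring G d = poly_ring (states d (verts G))"

definition graph_ideal :: "'v ugraph \<Rightarrow> ('v \<Rightarrow> nat) \<Rightarrow> ('v \<Rightarrow> nat) cpoly set" where
  "graph_ideal G d = {p \<in> carrier (graph_poly_ring G d).
     \<forall>x \<in> param_map G d ` param_space G d. eval_poly x p = 0}"

end

theory Submission
  imports "HOL-Library.Ramsey" "HOL-Library.Multiset" Defs
begin

text \<open>
  A monomial is a multiset of states of the glued graph, and each copy of a piece (a \<open>column\<close>)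
  sees it through the multiset of restrictions to that copy. Every clique lies in a single column,
  so two monomials are congruent modulo the ideal iff all their columns have equal clique marginals,
  and by independence of characters the ideal is spanned by the binomials of congruent monomials.

  Two states that agree on the shared nodes may exchange one column; this is a quadric. Modulo these
  quadrics a monomial splits as a product with prescribed column contents whenever these are
  sub-multisets of its columns with a common restriction to the shared nodes. Hence a congruent
  pair \<open>(M, M')\<close> reduces to pairs of smaller degree as soon as the set of contents \<open>(U, U')\<close>
  of its columns is dominated by such a set of smaller positive degree, where \<open>W0\<close> dominates \<open>W\<close>
  if every element of \<open>W\<close> lies above some element of \<open>W0\<close>, irrespective of the number of columns.
  As column contents live in a fixed \<open>\<nat>\<^sup>p\<close>, Ramsey's theorem for triples shows that no infinite sequence
  of such sets avoids domination, which bounds the degrees of the irreducible pairs.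
\<close>

section \<open>Domination of sets of column contents\<close>

lemma triple_array_increasing:
  fixes g :: "'j \<Rightarrow> 'x \<Rightarrow> nat" and F :: "nat \<Rightarrow> nat \<Rightarrow> 'x"
  assumes "finite J"
  shows "\<exists>k l m. k < l \<and> l < m \<and> (\<forall>j\<in>J. g j (F k l) \<le> g j (F l m))"
proof -
  obtain n and h :: "nat \<Rightarrow> 'j" where h: "bij_betw h {0..<n} J"
    using ex_bij_betw_nat_finite[OF assms] by blast
  define bad where "bad k l m = (LEAST j. j = n \<or> g (h j) (F l m) < g (h j) (F k l))" for k l m
  define colour where "colour X =
    (let k = Min X; l = Min (X - {k}); m = Min (X - {k, l}) in bad k l m)" for X
  have bad_le: "bad k l m \<le> n" for k l m
    unfolding bad_def by (rule Least_le) simp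
  have bad: "bad k l m = n \<or> g (h (bad k l m)) (F l m) < g (h (bad k l m)) (F k l)" for k l m
    unfolding bad_def by (rule LeastI[where k = n]) simp
  have colour: "colour {k, l, m} = bad k l m" if "k < l" "l < m" for k l m
  proof -
    have 1: "Min {k, l, m} = k" using that by (intro Min_eqI) auto
    have 2: "{k, l, m} - {k} = {l, m}" using that by auto
    have 3: "Min {l, m} = l" using that by (intro Min_eqI) auto
    have 4: "{k, l, m} - {k, l} = {m}" using that by auto
    show ?thesis unfolding colour_def Let_def 1 2 3 4 by simp
  qed
  have colour_le: "\<forall>X. X \<subseteq> UNIV \<and> finite X \<and> card X = 3 \<longrightarrow> colour X < Suc n"
    using bad_le by (auto simp: colour_def Let_def less_Suc_eq_le)
  obtain Y t where Y: "infinite Y" and t: "\<And>X. X \<subseteq> Y \<Longrightarrow> finite X \<Longrightarrow> card X = 3 \<Longrightarrow> colour X = t"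
    using Ramsey[OF infinite_UNIV_nat colour_le] by (elim exE conjE) simp
  define e where "e = enumerate Y"
  have e: "strict_mono e" "\<And>i. e i \<in> Y"
    using Y unfolding e_def by (auto simp: strict_mono_enumerate enumerate_in_set)
  have t_eq: "bad (e i) (e (Suc i)) (e (Suc (Suc i))) = t" for i
  proof -
    have less: "e i < e (Suc i)" "e (Suc i) < e (Suc (Suc i))"
      using e(1) by (auto simp: strict_mono_def)
    have "colour {e i, e (Suc i), e (Suc (Suc i))} = t"
      by (rule t) (use less e(2) in auto)
    then show ?thesis using colour[OF less] by simp
  qed
  have "t = n"
  proof (rule ccontr)
    assume "t \<noteq> n"
    then have "g (h t) (F (e (Suc i)) (e (Suc (Suc i)))) < g (h t) (F (e i) (e (Suc i)))" for i
      using bad[of "e i" "e (Suc i)" "e (Suc (Suc i))"] t_eq[of i] by simp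
    then have "\<exists>f :: nat \<Rightarrow> nat. \<forall>i. (f (Suc i), f i) \<in> less_than"
      by (intro exI[of _ "\<lambda>i. g (h t) (F (e i) (e (Suc i)))"]) simp
    then show False
      using wf_less_than unfolding wf_iff_no_infinite_down_chain by blast
  qed
  have "g j (F (e 0) (e 1)) \<le> g j (F (e 1) (e 2))" if "j \<in> J" for j
  proof (rule ccontr)
    assume *: "\<not> ?thesis"
    obtain i where i: "i < n" "h i = j"
      using h \<open>j \<in> J\<close> unfolding bij_betw_def by (auto simp: image_iff)
    have "bad (e 0) (e 1) (e 2) \<le> i"
      unfolding bad_def by (rule Least_le) (use * i in auto)
    then show False
      using t_eq[of 0] \<open>t = n\<close> i(1) by (simp add: numeral_2_eq_2)
  qed
  moreover have "e 0 < e 1" "e 1 < e 2"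
    using e(1) by (auto simp: strict_mono_def)
  ultimately show ?thesis by blast
qed

text \<open>An element \<open>(i, U, U')\<close> of a profile records a column of type \<open>i\<close> with its contents in the two
  monomials of a pair.\<close>

type_synonym ('i, 'y) profile = "('i \<times> 'y multiset \<times> 'y multiset) set"

definition dominated :: "('i, 'y) profile \<Rightarrow> ('i, 'y) profile \<Rightarrow> bool" where
  "dominated W0 W \<longleftrightarrow> (\<forall>(i, U, U')\<in>W. \<exists>U0 U0'. (i, U0, U0') \<in> W0 \<and> U0 \<subseteq># U \<and> U0' \<subseteq># U')"

lemma profile_sequence_good:
  fixes W :: "nat \<Rightarrow> ('i, 'y) profile"
  assumes "finite I" "finite Y"
    and W: "\<And>k i U U'. (i, U, U') \<in> W k \<Longrightarrow> i \<in> I \<and> set_mset U \<subseteq> Y \<and> set_mset U' \<subseteq> Y"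
  shows "\<exists>k l. k < l \<and> dominated (W k) (W l)"
proof (rule ccontr)
  define below where "below y x \<longleftrightarrow> fst y = fst x \<and> fst (snd y) \<subseteq># fst (snd x) \<and> snd (snd y) \<subseteq># snd (snd x)"
    for x y :: "'i \<times> 'y multiset \<times> 'y multiset"
  assume bad: "\<not> ?thesis"
  have ex: "\<exists>x\<in>W l. \<forall>y\<in>W k. \<not> below y x" if "k < l" for k l
  proof -
    from bad that have "\<not> dominated (W k) (W l)" by blast
    then obtain i U U' where "(i, U, U') \<in> W l"
      and "\<And>U0 U0'. (i, U0, U0') \<in> W k \<Longrightarrow> \<not> (U0 \<subseteq># U \<and> U0' \<subseteq># U')"
      unfolding dominated_def by blast
    then show ?thesis
      by (intro bexI[of _ "(i, U, U')"]) (auto simp: below_def)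
  qed
  define F where "F k l = (SOME x. x \<in> W l \<and> (\<forall>y\<in>W k. \<not> below y x))" for k l
  have F: "F k l \<in> W l \<and> (\<forall>y\<in>W k. \<not> below y (F k l))" if "k < l" for k l
    unfolding F_def by (rule someI_ex) (use ex[OF that] in blast)
  define g :: "'i + 'y + 'y \<Rightarrow> 'i \<times> 'y multiset \<times> 'y multiset \<Rightarrow> nat" where
    "g j x = (case j of Inl i \<Rightarrow> (if fst x = i then 1 else 0)
      | Inr (Inl y) \<Rightarrow> count (fst (snd x)) y | Inr (Inr y) \<Rightarrow> count (snd (snd x)) y)" for j x
  have "finite (I <+> (Y <+> Y))" using assms by auto
  from triple_array_increasing[OF this, of g F] obtain k l m where
    klm: "k < l" "l < m" and le: "\<forall>j\<in>I <+> (Y <+> Y). g j (F k l) \<le> g j (F l m)"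
    by blast
  obtain i U U' i2 V V' where x: "F k l = (i, U, U')" and y: "F l m = (i2, V, V')"
    by (metis prod_cases3)
  have "i \<in> I" "set_mset U \<subseteq> Y" "set_mset U' \<subseteq> Y"
    using W[of i U U' l] F[OF klm(1)] x by auto
  have "i2 = i"
    using le[rule_format, of "Inl i"] \<open>i \<in> I\<close> by (simp add: g_def x y InlI split: if_splits)
  moreover have "U \<subseteq># V"
    unfolding subseteq_mset_def
  proof
    fix z show "count U z \<le> count V z"
    proof (cases "z \<in> Y")
      case True
      then show ?thesis using le[rule_format, of "Inr (Inl z)"] by (simp add: g_def x y InlI InrI)
    next
      case False
      then have "count U z = 0" using \<open>set_mset U \<subseteq> Y\<close> by (auto simp: count_eq_zero_iff)
      then show ?thesis by simp
    qed
  qed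
  moreover have "U' \<subseteq># V'"
    unfolding subseteq_mset_def
  proof
    fix z show "count U' z \<le> count V' z"
    proof (cases "z \<in> Y")
      case True
      then show ?thesis using le[rule_format, of "Inr (Inr z)"] by (simp add: g_def x y InlI InrI)
    next
      case False
      then have "count U' z = 0" using \<open>set_mset U' \<subseteq> Y\<close> by (auto simp: count_eq_zero_iff)
      then show ?thesis by simp
    qed
  qed
  ultimately show False
    using bspec[OF conjunct2[OF F[OF klm(2)]] conjunct1[OF F[OF klm(1)]]] x y by (simp add: below_def)
qed

definition same_marginals :: "('y \<Rightarrow> 'w) set \<Rightarrow> 'y multiset \<Rightarrow> 'y multiset \<Rightarrow> bool" where
  "same_marginals \<Phi> U U' \<longleftrightarrow> (\<forall>f\<in>\<Phi>. image_mset f U = image_mset f U')"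

definition profile_of_size ::
    "('y \<Rightarrow> 'z) \<Rightarrow> 'i set \<Rightarrow> ('i \<Rightarrow> 'y set) \<Rightarrow> ('i \<Rightarrow> ('y \<Rightarrow> 'w) set) \<Rightarrow> nat \<Rightarrow> ('i, 'y) profile \<Rightarrow> bool" where
  "profile_of_size \<rho> I Y \<Phi> n W \<longleftrightarrow>
     (\<forall>(i, U, U')\<in>W. i \<in> I \<and> set_mset U \<subseteq> Y i \<and> set_mset U' \<subseteq> Y i \<and> same_marginals (\<Phi> i) U U') \<and>
     (\<exists>P P'. size P = n \<and> size P' = n \<and>
       (\<forall>(i, U, U')\<in>W. image_mset \<rho> U = P \<and> image_mset \<rho> U' = P'))"

lemma bounded_indecomposable_profiles:
  fixes \<rho> :: "'y \<Rightarrow> 'z" and \<Phi> :: "'i \<Rightarrow> ('y \<Rightarrow> 'w) set"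
  assumes "finite I" and "\<And>i. i \<in> I \<Longrightarrow> finite (Y i)"
  obtains D where "\<And>n W. profile_of_size \<rho> I Y \<Phi> n W \<Longrightarrow> n > D \<Longrightarrow>
    \<exists>n0 W0. profile_of_size \<rho> I Y \<Phi> n0 W0 \<and> 0 < n0 \<and> n0 < n \<and> dominated W0 W"
proof -
  have "\<exists>D. \<forall>n W. profile_of_size \<rho> I Y \<Phi> n W \<longrightarrow> n > D \<longrightarrow>
    (\<exists>n0 W0. profile_of_size \<rho> I Y \<Phi> n0 W0 \<and> 0 < n0 \<and> n0 < n \<and> dominated W0 W)"
  proof (rule ccontr)
    assume "\<not> ?thesis"
    then have "\<forall>D. \<exists>n W. profile_of_size \<rho> I Y \<Phi> n W \<and> n > D \<and>
      (\<forall>n0 W0. profile_of_size \<rho> I Y \<Phi> n0 W0 \<longrightarrow> 0 < n0 \<longrightarrow> n0 < n \<longrightarrow> \<not> dominated W0 W)"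
      by blast
    then obtain N V where NV: "\<And>D. profile_of_size \<rho> I Y \<Phi> (N D) (V D)" "\<And>D. N D > D"
      "\<And>D n0 W0. profile_of_size \<rho> I Y \<Phi> n0 W0 \<Longrightarrow> 0 < n0 \<Longrightarrow> n0 < N D \<Longrightarrow> \<not> dominated W0 (V D)"
      by metis
    define e where "e k = (N ^^ k) 0" for k
    have e_Suc: "e (Suc k) = N (e k)" for k by (simp add: e_def)
    have "strict_mono e"
      unfolding strict_mono_Suc_iff using NV(2) by (simp add: e_Suc)
    have W: "i \<in> I \<and> set_mset U \<subseteq> (\<Union>i\<in>I. Y i) \<and> set_mset U' \<subseteq> (\<Union>i\<in>I. Y i)"
      if "(i, U, U') \<in> V (e k)" for k i U U'
    proof -
      have "case (i, U, U') of (i, U, U') \<Rightarrow> i \<in> I \<and> set_mset U \<subseteq> Y i \<and> set_mset U' \<subseteq> Y i \<and> same_marginals (\<Phi> i) U U'"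
        using NV(1)[of "e k"] that unfolding profile_of_size_def by (elim conjE) (rule bspec)
      then show ?thesis by auto
    qed
    obtain k l where kl: "k < l" "dominated (V (e k)) (V (e l))"
      using profile_sequence_good[of I "\<Union>i\<in>I. Y i" "\<lambda>k. V (e k)"] assms W by auto
    have "e (Suc k) < e (Suc l)"
      using \<open>strict_mono e\<close> kl(1) by (simp add: strict_mono_def)
    then have "N (e k) < N (e l)" by (simp add: e_Suc)
    moreover have "N (e k) > 0" using NV(2)[of "e k"] by simp
    ultimately show False using NV(3)[OF NV(1)] kl(2) by blast
  qed
  then show ?thesis using that by blast
qed

section \<open>Exchanging columns\<close>

locale column_system =
  fixes S :: "'x set" and Cols :: "'c set" and col :: "'x \<Rightarrow> 'c \<Rightarrow> 'y"
    and \<tau> :: "'c \<Rightarrow> 'i" and I :: "'i set" and Y :: "'i \<Rightarrow> 'y set" and \<rho> :: "'y \<Rightarrow> 'z"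
    and \<Phi> :: "'i \<Rightarrow> ('y \<Rightarrow> 'w) set"
  assumes finite_Cols: "finite Cols" and Cols_ne: "Cols \<noteq> {}"
    and type_in: "c \<in> Cols \<Longrightarrow> \<tau> c \<in> I"
    and marginals_ne: "i \<in> I \<Longrightarrow> \<Phi> i \<noteq> {}"
    and col_in: "\<beta> \<in> S \<Longrightarrow> c \<in> Cols \<Longrightarrow> col \<beta> c \<in> Y (\<tau> c)"
    and base_eq: "\<beta> \<in> S \<Longrightarrow> c \<in> Cols \<Longrightarrow> c' \<in> Cols \<Longrightarrow> \<rho> (col \<beta> c) = \<rho> (col \<beta> c')"
    and amalgam: "(\<And>c. c \<in> Cols \<Longrightarrow> \<sigma> c \<in> Y (\<tau> c) \<and> \<rho> (\<sigma> c) = r) \<Longrightarrow>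
      \<exists>\<beta>\<in>S. \<forall>c\<in>Cols. col \<beta> c = \<sigma> c"
begin

definition colm :: "'c \<Rightarrow> 'x multiset \<Rightarrow> 'y multiset" where
  "colm c M = image_mset (\<lambda>\<beta>. col \<beta> c) M"

definition equiv_marginals :: "'x multiset \<Rightarrow> 'x multiset \<Rightarrow> bool" where
  "equiv_marginals M M' \<longleftrightarrow> (\<forall>c\<in>Cols. same_marginals (\<Phi> (\<tau> c)) (colm c M) (colm c M'))"

lemma colm_simps [simp]:
  "colm c {#} = {#}" "colm c (add_mset \<beta> M) = add_mset (col \<beta> c) (colm c M)"
  "colm c (M + M') = colm c M + colm c M'" "size (colm c M) = size M"
  by (auto simp: colm_def)

lemma set_colm: "set_mset M \<subseteq> S \<Longrightarrow> c \<in> Cols \<Longrightarrow> set_mset (colm c M) \<subseteq> Y (\<tau> c)"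
  using col_in by (auto simp: colm_def)

lemma equiv_marginals_size:
  assumes "equiv_marginals M M'" shows "size M = size M'"
proof -
  obtain c where c: "c \<in> Cols" using Cols_ne by blast
  obtain f where "f \<in> \<Phi> (\<tau> c)" using marginals_ne type_in c by blast
  then have "image_mset f (colm c M) = image_mset f (colm c M')"
    using assms c by (auto simp: equiv_marginals_def same_marginals_def)
  then have "size (image_mset f (colm c M)) = size (image_mset f (colm c M'))" by simp
  then show ?thesis by simp
qed

lemma exchange:
  assumes "\<beta> \<in> S" "\<gamma> \<in> S" "c \<in> Cols" "\<rho> (col \<beta> c) = \<rho> (col \<gamma> c)"
  obtains \<beta>' \<gamma>' where "\<beta>' \<in> S" "\<gamma>' \<in> S"
    "\<And>c'. c' \<in> Cols \<Longrightarrow> col \<beta>' c' = (if c' = c then col \<gamma> c' else col \<beta> c')"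
    "\<And>c'. c' \<in> Cols \<Longrightarrow> col \<gamma>' c' = (if c' = c then col \<beta> c' else col \<gamma> c')"
proof -
  have *: "\<exists>\<beta>'\<in>S. \<forall>c'\<in>Cols. col \<beta>' c' = (if c' = c then col \<gamma> c' else col \<beta> c')"
    if "\<beta> \<in> S" "\<gamma> \<in> S" "\<rho> (col \<beta> c) = \<rho> (col \<gamma> c)" for \<beta> \<gamma>
  proof (rule amalgam[of _ "\<rho> (col \<beta> c)"])
    fix c' assume c': "c' \<in> Cols"
    show "(if c' = c then col \<gamma> c' else col \<beta> c') \<in> Y (\<tau> c') \<and>
        \<rho> (if c' = c then col \<gamma> c' else col \<beta> c') = \<rho> (col \<beta> c)"
      using that(3) col_in[OF that(1) c'] col_in[OF that(2) c'] base_eq[OF that(1) c' assms(3)] by auto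
  qed
  obtain \<beta>' where "\<beta>' \<in> S" "\<forall>c'\<in>Cols. col \<beta>' c' = (if c' = c then col \<gamma> c' else col \<beta> c')"
    using *[of \<beta> \<gamma>] assms by blast
  moreover obtain \<gamma>' where "\<gamma>' \<in> S" "\<forall>c'\<in>Cols. col \<gamma>' c' = (if c' = c then col \<beta> c' else col \<gamma> c')"
    using *[of \<gamma> \<beta>] assms by auto
  ultimately show ?thesis using that[of \<beta>' \<gamma>'] by blast
qed

end

text \<open>\<open>2 \<le> D\<close> puts the exchanges of one column between two states into \<open>R\<close>.\<close>

locale column_congruence = column_system S Cols col \<tau> I Y \<rho> \<Phi>
  for S :: "'x set" and Cols :: "'c set" and col :: "'x \<Rightarrow> 'c \<Rightarrow> 'y"
    and \<tau> :: "'c \<Rightarrow> 'i" and I :: "'i set" and Y :: "'i \<Rightarrow> 'y set" and \<rho> :: "'y \<Rightarrow> 'z"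
    and \<Phi> :: "'i \<Rightarrow> ('y \<Rightarrow> 'w) set" +
  fixes R :: "'x multiset \<Rightarrow> 'x multiset \<Rightarrow> bool" and D :: nat
  assumes R_sym: "R M M' \<Longrightarrow> R M' M"
    and R_trans: "R M M' \<Longrightarrow> R M' M'' \<Longrightarrow> R M M''"
    and R_add: "R M M' \<Longrightarrow> set_mset L \<subseteq> S \<Longrightarrow> R (L + M) (L + M')"
    and R_small: "set_mset M \<subseteq> S \<Longrightarrow> set_mset M' \<subseteq> S \<Longrightarrow> equiv_marginals M M' \<Longrightarrow> size M \<le> D \<Longrightarrow> R M M'"
    and two_le: "2 \<le> D"
begin

lemma R_refl: "set_mset M \<subseteq> S \<Longrightarrow> R M M"
proof -
  assume M: "set_mset M \<subseteq> S"
  have "R {#} {#}"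
    by (rule R_small) (auto simp: equiv_marginals_def same_marginals_def)
  from R_add[OF this M] show ?thesis by simp
qed

lemma expose:
  assumes "finite T" "T \<subseteq> Cols" "set_mset M \<subseteq> S" "\<beta> \<in> S"
    and "\<And>c. c \<in> Cols \<Longrightarrow> col \<beta> c \<in># colm c M"
  shows "\<exists>\<beta>' N. \<beta>' \<in> S \<and> set_mset N \<subseteq> S \<and> R M (add_mset \<beta>' N) \<and>
    (\<forall>c\<in>Cols. colm c (add_mset \<beta>' N) = colm c M \<and> \<rho> (col \<beta>' c) = \<rho> (col \<beta> c)) \<and>
    (\<forall>c\<in>T. col \<beta>' c = col \<beta> c)"
  using assms(1,2)
proof (induction T rule: finite_induct)
  case empty
  obtain c0 where c0: "c0 \<in> Cols" using Cols_ne by blast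
  obtain \<beta>' where \<beta>': "\<beta>' \<in># M" "col \<beta>' c0 = col \<beta> c0"
    using assms(5)[OF c0] by (auto simp: colm_def)
  then obtain N where N: "M = add_mset \<beta>' N" by (meson mset_add)
  have "\<rho> (col \<beta>' c) = \<rho> (col \<beta> c)" if "c \<in> Cols" for c
    using base_eq[of \<beta>' c c0] base_eq[of \<beta> c c0] \<beta>' c0 that assms(3,4) by auto
  then show ?case
    using N assms(3) R_refl[OF assms(3)] by (intro exI[of _ \<beta>'] exI[of _ N]) auto
next
  case (insert c T)
  then obtain \<beta>1 N where IH: "\<beta>1 \<in> S" "set_mset N \<subseteq> S" "R M (add_mset \<beta>1 N)"
    "\<And>c. c \<in> Cols \<Longrightarrow> colm c (add_mset \<beta>1 N) = colm c M"
    "\<And>c. c \<in> Cols \<Longrightarrow> \<rho> (col \<beta>1 c) = \<rho> (col \<beta> c)"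
    "\<And>c. c \<in> T \<Longrightarrow> col \<beta>1 c = col \<beta> c" by auto
  have c: "c \<in> Cols" using insert by auto
  show ?case
  proof (cases "col \<beta>1 c = col \<beta> c")
    case True
    then show ?thesis using IH by (intro exI[of _ \<beta>1] exI[of _ N]) auto
  next
    case False
    have "col \<beta> c \<in># colm c (add_mset \<beta>1 N)" using IH(4)[OF c] assms(5)[OF c] by simp
    then obtain \<gamma> where \<gamma>: "\<gamma> \<in># N" "col \<gamma> c = col \<beta> c"
      using False by (auto simp: colm_def)
    then obtain L where L: "N = add_mset \<gamma> L" by (meson mset_add)
    have "\<gamma> \<in> S" using \<gamma> IH(2) by auto
    obtain \<beta>2 \<gamma>2 where ex: "\<beta>2 \<in> S" "\<gamma>2 \<in> S"
      "\<And>c'. c' \<in> Cols \<Longrightarrow> col \<beta>2 c' = (if c' = c then col \<gamma> c' else col \<beta>1 c')"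
      "\<And>c'. c' \<in> Cols \<Longrightarrow> col \<gamma>2 c' = (if c' = c then col \<beta>1 c' else col \<gamma> c')"
      using exchange[OF IH(1) \<open>\<gamma> \<in> S\<close> c] IH(5)[OF c] \<gamma>(2) by auto
    have same: "colm c' {#\<beta>1, \<gamma>#} = colm c' {#\<beta>2, \<gamma>2#}" if "c' \<in> Cols" for c'
      using ex(3,4)[OF that] by (auto simp: add_mset_commute)
    have "R {#\<beta>1, \<gamma>#} {#\<beta>2, \<gamma>2#}"
      by (rule R_small)
         (use ex(1,2) IH(1) \<open>\<gamma> \<in> S\<close> same two_le in \<open>auto simp: equiv_marginals_def same_marginals_def\<close>)
    then have "R (L + {#\<beta>1, \<gamma>#}) (L + {#\<beta>2, \<gamma>2#})"
      by (rule R_add) (use IH(2) L in auto)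
    then have "R (add_mset \<beta>1 N) (add_mset \<beta>2 (add_mset \<gamma>2 L))"
      by (simp add: L)
    then have "R M (add_mset \<beta>2 (add_mset \<gamma>2 L))" using IH(3) R_trans by blast
    moreover have "colm c' (add_mset \<beta>2 (add_mset \<gamma>2 L)) = colm c' M" if "c' \<in> Cols" for c'
    proof -
      have "colm c' (add_mset \<beta>2 (add_mset \<gamma>2 L)) = colm c' {#\<beta>2, \<gamma>2#} + colm c' L" by simp
      also have "\<dots> = colm c' (add_mset \<beta>1 N)" unfolding same[OF that, symmetric] L by simp
      finally show ?thesis using IH(4)[OF that] by simp
    qed
    moreover have "\<rho> (col \<beta>2 c') = \<rho> (col \<beta> c')" if "c' \<in> Cols" for c'
      using ex(3)[OF that] IH(5)[OF that] \<gamma>(2) by simp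
    moreover have "col \<beta>2 c' = col \<beta> c'" if "c' \<in> insert c T" for c'
      using ex(3)[of c'] \<gamma>(2) IH(6)[of c'] that insert.prems by auto
    ultimately show ?thesis
      using ex(1,2) IH(2) L by (intro exI[of _ \<beta>2] exI[of _ "add_mset \<gamma>2 L"]) auto
  qed
qed

lemma split_prescribed_columns:
  assumes "set_mset M \<subseteq> S"
    and "\<And>c. c \<in> Cols \<Longrightarrow> U c \<subseteq># colm c M \<and> image_mset \<rho> (U c) = P"
  shows "\<exists>B C. set_mset B \<subseteq> S \<and> set_mset C \<subseteq> S \<and> R M (B + C) \<and>
    (\<forall>c\<in>Cols. colm c (B + C) = colm c M \<and> colm c B = U c)"
  using assms
proof (induction P arbitrary: M U)
  case empty
  then show ?case using R_refl[of M] by (intro exI[of _ "{#}"] exI[of _ M]) auto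
next
  case (add r P)
  have "\<exists>y. y \<in># U c \<and> \<rho> y = r" if "c \<in> Cols" for c
  proof -
    have "r \<in># image_mset \<rho> (U c)" using add.prems(2)[OF that] by simp
    then show ?thesis by auto
  qed
  then obtain \<sigma> where \<sigma>: "\<And>c. c \<in> Cols \<Longrightarrow> \<sigma> c \<in># U c \<and> \<rho> (\<sigma> c) = r" by metis
  have \<sigma>M: "\<sigma> c \<in># colm c M" if "c \<in> Cols" for c
    using \<sigma>[OF that] add.prems(2)[OF that] mset_subset_eqD by metis
  have "\<exists>\<beta>\<in>S. \<forall>c\<in>Cols. col \<beta> c = \<sigma> c"
    by (rule amalgam[of _ r]) (use \<sigma> \<sigma>M set_colm[OF add.prems(1)] in auto)
  then obtain \<beta>0 where \<beta>0: "\<beta>0 \<in> S" "\<And>c. c \<in> Cols \<Longrightarrow> col \<beta>0 c = \<sigma> c" by blast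
  obtain \<beta> N where N: "\<beta> \<in> S" "set_mset N \<subseteq> S" "R M (add_mset \<beta> N)"
    "\<And>c. c \<in> Cols \<Longrightarrow> colm c (add_mset \<beta> N) = colm c M" "\<And>c. c \<in> Cols \<Longrightarrow> col \<beta> c = \<sigma> c"
    using expose[OF finite_Cols order_refl add.prems(1) \<beta>0(1)] \<beta>0(2) \<sigma>M by auto
  have "U c - {#\<sigma> c#} \<subseteq># colm c N \<and> image_mset \<rho> (U c - {#\<sigma> c#}) = P" if c: "c \<in> Cols" for c
  proof
    obtain V where V: "U c = add_mset (\<sigma> c) V" using \<sigma>[OF c] by (meson mset_add)
    have "add_mset (\<sigma> c) V \<subseteq># add_mset (\<sigma> c) (colm c N)"
      using add.prems(2)[OF c] N(4,5)[OF c] V by simp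
    then show "U c - {#\<sigma> c#} \<subseteq># colm c N" using V by simp
    show "image_mset \<rho> (U c - {#\<sigma> c#}) = P"
      using add.prems(2)[OF c] V \<sigma>[OF c] by simp
  qed
  from add.IH[OF N(2) this] obtain B C where BC: "set_mset B \<subseteq> S" "set_mset C \<subseteq> S" "R N (B + C)"
    "\<And>c. c \<in> Cols \<Longrightarrow> colm c (B + C) = colm c N" "\<And>c. c \<in> Cols \<Longrightarrow> colm c B = U c - {#\<sigma> c#}"
    by blast
  have "R ({#\<beta>#} + N) ({#\<beta>#} + (B + C))"
    by (rule R_add[OF BC(3)]) (use N(1) in auto)
  then have "R M (add_mset \<beta> B + C)" using R_trans N(3) by simp
  moreover have "colm c (add_mset \<beta> B + C) = colm c M" if "c \<in> Cols" for c
    using BC(4)[OF that] N(4)[OF that] by simp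
  moreover have "colm c (add_mset \<beta> B) = U c" if "c \<in> Cols" for c
    using BC(5)[OF that] N(5)[OF that] \<sigma>[OF that] by simp
  ultimately show ?case
    using BC(1,2) N(1) by (intro exI[of _ "add_mset \<beta> B"] exI[of _ C]) auto
qed

lemma same_marginals_Diff:
  assumes "same_marginals F U U'" "same_marginals F V V'" "V \<subseteq># U" "V' \<subseteq># U'"
  shows "same_marginals F (U - V) (U' - V')"
  using assms by (simp add: same_marginals_def image_mset_Diff)

theorem equiv_marginals_imp_R:
  assumes D: "\<And>n W. profile_of_size \<rho> I Y \<Phi> n W \<Longrightarrow> n > D \<Longrightarrow>
      \<exists>n0 W0. profile_of_size \<rho> I Y \<Phi> n0 W0 \<and> 0 < n0 \<and> n0 < n \<and> dominated W0 W"
    and "set_mset M \<subseteq> S" "set_mset M' \<subseteq> S" "equiv_marginals M M'"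
  shows "R M M'"
  using assms(2-)
proof (induction "size M" arbitrary: M M' rule: less_induct)
  case less
  note MS = less.prems(1) and MS' = less.prems(2) and eq = less.prems(3)
  show ?case
  proof (cases "size M \<le> D")
    case True
    then show ?thesis using R_small less.prems by blast
  next
    case False
    obtain c0 where c0: "c0 \<in> Cols" using Cols_ne by blast
    define W where "W = (\<lambda>c. (\<tau> c, colm c M, colm c M')) ` Cols"
    have img: "image_mset \<rho> (colm c M) = image_mset \<rho> (colm c0 M)"
      if "c \<in> Cols" "set_mset M \<subseteq> S" for c M
      unfolding colm_def multiset.map_comp
      by (rule image_mset_cong) (use base_eq that c0 in auto)
    have "profile_of_size \<rho> I Y \<Phi> (size M) W"
      unfolding profile_of_size_def
    proof
      show "\<forall>(i, U, U')\<in>W. i \<in> I \<and> set_mset U \<subseteq> Y i \<and> set_mset U' \<subseteq> Y i \<and> same_marginals (\<Phi> i) U U'"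
        unfolding W_def using type_in set_colm[OF MS] set_colm[OF MS'] eq by (auto simp: equiv_marginals_def)
      show "\<exists>P P'. size P = size M \<and> size P' = size M \<and>
         (\<forall>(i, U, U')\<in>W. image_mset \<rho> U = P \<and> image_mset \<rho> U' = P')"
        by (rule exI[of _ "image_mset \<rho> (colm c0 M)"], rule exI[of _ "image_mset \<rho> (colm c0 M')"])
           (use img MS MS' equiv_marginals_size[OF eq] in \<open>auto simp: W_def\<close>)
    qed
    with D False obtain n0 W0 where W0: "profile_of_size \<rho> I Y \<Phi> n0 W0" "0 < n0" "n0 < size M"
      "dominated W0 W" by (meson not_le)
    have "\<exists>U0 U0'. (\<tau> c, U0, U0') \<in> W0 \<and> U0 \<subseteq># colm c M \<and> U0' \<subseteq># colm c M'" if "c \<in> Cols" for c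
      using W0(4) that unfolding dominated_def W_def by auto
    then obtain U U' where U: "\<And>c. c \<in> Cols \<Longrightarrow> (\<tau> c, U c, U' c) \<in> W0"
      "\<And>c. c \<in> Cols \<Longrightarrow> U c \<subseteq># colm c M" "\<And>c. c \<in> Cols \<Longrightarrow> U' c \<subseteq># colm c M'"
      by metis
    from W0(1) obtain P P' where P: "size P = n0" "size P' = n0"
      "\<forall>(i, U, U')\<in>W0. image_mset \<rho> U = P \<and> image_mset \<rho> U' = P'"
      and W0': "\<forall>(i, U, U')\<in>W0. i \<in> I \<and> set_mset U \<subseteq> Y i \<and> set_mset U' \<subseteq> Y i \<and> same_marginals (\<Phi> i) U U'"
      unfolding profile_of_size_def by auto
    have imgU: "image_mset \<rho> (U c) = P" "image_mset \<rho> (U' c) = P'" "same_marginals (\<Phi> (\<tau> c)) (U c) (U' c)"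
      if "c \<in> Cols" for c
      using bspec[OF P(3) U(1)[OF that]] bspec[OF W0' U(1)[OF that]] by auto
    obtain B C where BC: "set_mset B \<subseteq> S" "set_mset C \<subseteq> S" "R M (B + C)"
      "\<And>c. c \<in> Cols \<Longrightarrow> colm c (B + C) = colm c M" "\<And>c. c \<in> Cols \<Longrightarrow> colm c B = U c"
      using split_prescribed_columns[OF MS, of U P] U(2) imgU(1) by blast
    obtain B' C' where BC': "set_mset B' \<subseteq> S" "set_mset C' \<subseteq> S" "R M' (B' + C')"
      "\<And>c. c \<in> Cols \<Longrightarrow> colm c (B' + C') = colm c M'" "\<And>c. c \<in> Cols \<Longrightarrow> colm c B' = U' c"
      using split_prescribed_columns[OF MS', of U' P'] U(3) imgU(2) by blast
    have C: "colm c C = colm c M - U c" "colm c C' = colm c M' - U' c" if "c \<in> Cols" for c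
      using BC(4,5)[OF that, symmetric] BC'(4,5)[OF that, symmetric] by simp_all
    have eqB: "equiv_marginals B B'"
      using BC(5) BC'(5) imgU(3) by (simp add: equiv_marginals_def)
    have eqC: "equiv_marginals C C'"
      unfolding equiv_marginals_def
    proof
      fix c assume c: "c \<in> Cols"
      have "same_marginals (\<Phi> (\<tau> c)) (colm c M) (colm c M')"
        using eq c by (simp add: equiv_marginals_def)
      then show "same_marginals (\<Phi> (\<tau> c)) (colm c C) (colm c C')"
        unfolding C[OF c] using imgU(3)[OF c] U(2,3)[OF c] by (rule same_marginals_Diff)
    qed
    have "size B = n0" using BC(5)[OF c0] imgU(1)[OF c0] P(1) by (metis colm_simps(4) size_image_mset)
    moreover have "size B + size C = size M" using BC(4)[OF c0] by (metis colm_simps(4) size_union)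
    ultimately have "size B < size M" "size C < size M" using W0(2,3) by auto
    then have "R B B'" "R C C'"
      using less.hyps BC(1,2) BC'(1,2) eqB eqC by blast+
    then have "R (C + B) (C + B')" "R (B' + C) (B' + C')"
      using R_add BC(2) BC'(1) by blast+
    then have "R (B + C) (B' + C')" using R_trans by (metis add.commute)
    then show ?thesis using BC(3) BC'(3) R_trans R_sym by blast
  qed
qed

end

section \<open>Cliques and states of a glued graph\<close>

text \<open>The column \<open>(0, 1)\<close> is \<open>H\<close> itself; it guarantees that there is a column when all multiplicities vanish.\<close>

definition columns :: "nat \<Rightarrow> (nat \<Rightarrow> nat) \<Rightarrow> (nat \<times> nat) set" where
  "columns s a = insert (0, 1) (SIGMA i:{1..s}. {1..a i})"

definition piece :: "'v ugraph \<Rightarrow> (nat \<Rightarrow> 'v ugraph) \<Rightarrow> nat \<Rightarrow> 'v ugraph" where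
  "piece H G i = (if i = 0 then H else G i)"

lemma embed_copy_eq_Shared [simp]:
  "embed_copy N i k u = Shared v \<longleftrightarrow> u \<in> N \<and> u = v"
  "Shared v = embed_copy N i k u \<longleftrightarrow> u \<in> N \<and> u = v"
  by (auto simp: embed_copy_def)

lemma embed_copy_eq_Copy [simp]:
  "embed_copy N i k u = Copy i' k' v \<longleftrightarrow> u \<notin> N \<and> i = i' \<and> k = k' \<and> u = v"
  "Copy i' k' v = embed_copy N i k u \<longleftrightarrow> u \<notin> N \<and> i = i' \<and> k = k' \<and> u = v"
  by (auto simp: embed_copy_def)

lemma label_embed_copy [simp]: "label (embed_copy N i k u) = u"
  by (simp add: embed_copy_def)

lemma label_image_embed_copy [simp]: "label ` embed_copy N i k ` A = A"
  by (simp add: image_image)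

lemma finite_mcl: "finite (verts G) \<Longrightarrow> finite (mcl G)"
  by (rule finite_subset[of _ "Pow (verts G)"]) (auto simp: mcl_def clique_def)

lemma clique_extends_to_mcl:
  assumes "finite (verts G)" "clique G C"
  obtains C' where "C' \<in> mcl G" "C \<subseteq> C'"
proof -
  have "finite {C. clique G C}"
    by (rule finite_subset[of _ "Pow (verts G)"]) (use assms(1) in \<open>auto simp: clique_def\<close>)
  from finite_has_maximal2[OF this, of C] assms(2) obtain C' where
    "clique G C'" "C \<subseteq> C'" "\<forall>C''\<in>{C. clique G C}. C' \<subseteq> C'' \<longrightarrow> C' = C''" by auto
  then have "C' \<in> mcl G" by (auto simp: mcl_def)
  then show ?thesis using \<open>C \<subseteq> C'\<close> by (rule that)
qed

locale glueing =
  fixes s :: nat and G :: "nat \<Rightarrow> 'v ugraph" and H :: "'v ugraph" and d :: "'v \<Rightarrow> nat"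
  assumes simple_pieces: "\<And>i. i \<in> {1..s} \<Longrightarrow> simple_graph (G i)"
    and simple_base: "simple_graph H"
    and base_sub: "\<And>i. i \<in> {1..s} \<Longrightarrow> verts H \<subseteq> verts (G i)"
    and base_induced: "\<And>i. i \<in> {1..s} \<Longrightarrow> induced_subgraph (G i) (verts H) = H"
begin

abbreviation P :: "nat \<Rightarrow> 'v ugraph" where "P \<equiv> piece H G"

abbreviation emb :: "nat \<times> nat \<Rightarrow> 'v \<Rightarrow> 'v gnode" where
  "emb c \<equiv> embed_copy (verts H) (fst c) (snd c)"

lemma simple_piece: "i \<in> {0..s} \<Longrightarrow> simple_graph (P i)"
  using simple_base simple_pieces by (auto simp: piece_def)

lemma piece_sub: "i \<in> {0..s} \<Longrightarrow> verts H \<subseteq> verts (P i)"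
  using base_sub by (auto simp: piece_def)

lemma edges_base: "edges H = {e \<in> edges (P i). e \<subseteq> verts H}" if "i \<in> {0..s}"
proof (cases "i = 0")
  case True
  then show ?thesis using simple_base by (auto simp: piece_def simple_graph_def)
next
  case False
  then have "edges (induced_subgraph (G i) (verts H)) = edges H" using base_induced[of i] that by simp
  then show ?thesis using False by (simp add: piece_def induced_subgraph_def)
qed

lemma fst_column: "c \<in> columns s a \<Longrightarrow> fst c \<in> {0..s}"
  by (auto simp: columns_def)

lemma emb_base: "A \<subseteq> verts H \<Longrightarrow> emb c ` A = Shared ` A"
  by (rule image_cong) (auto simp: embed_copy_def)

lemma verts_glue: "verts (glue H s G a) = (\<Union>c\<in>columns s a. emb c ` verts (P (fst c)))"
proof -
  have "(\<Union>c\<in>(SIGMA i:{1..s}. {1..a i}). emb c ` verts (P (fst c))) =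
      (\<Union>i\<in>{1..s}. \<Union>k\<in>{1..a i}. embed_copy (verts H) i k ` verts (G i))"
    unfolding Sigma_def UN_UN_flatten by (simp add: piece_def)
  then show ?thesis
    using emb_base[of "verts H" "(0, 1)"] by (simp add: glue_def columns_def piece_def)
qed

lemma edges_glue: "edges (glue H s G a) = (\<Union>c\<in>columns s a. (`) (emb c) ` edges (P (fst c)))"
proof -
  have "(`) (emb (0, 1)) ` edges H = (`) Shared ` edges H"
    by (rule image_cong) (use simple_base emb_base[of _ "(0, 1)"] in \<open>auto simp: simple_graph_def\<close>)
  moreover have "(\<Union>c\<in>(SIGMA i:{1..s}. {1..a i}). (`) (emb c) ` edges (P (fst c))) =
      (\<Union>i\<in>{1..s}. \<Union>k\<in>{1..a i}. (`) (embed_copy (verts H) i k) ` edges (G i))"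
    unfolding Sigma_def UN_UN_flatten by (simp add: piece_def)
  ultimately show ?thesis by (simp add: glue_def columns_def piece_def)
qed

lemma finite_columns: "finite (columns s a)"
  by (simp add: columns_def)

lemma finite_verts_glue: "finite (verts (glue H s G a))"
  unfolding verts_glue using finite_columns fst_column simple_piece
  by (auto simp: simple_graph_def)

lemma edge_glueD:
  assumes c: "c \<in> columns s a" and uv: "u \<in> verts (P (fst c))" "v \<in> verts (P (fst c))"
    and e: "{emb c u, emb c v} \<in> edges (glue H s G a)"
  shows "{u, v} \<in> edges (P (fst c))"
proof -
  obtain c' e' where c': "c' \<in> columns s a" "e' \<in> edges (P (fst c'))" "emb c' ` e' = {emb c u, emb c v}"
    using e unfolding edges_glue by auto
  have "label ` emb c' ` e' = {u, v}" unfolding c'(3) by simp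
  then have e': "e' = {u, v}" by simp
  show ?thesis
  proof (cases "u \<in> verts H \<and> v \<in> verts H")
    case True
    then have "{u, v} \<in> edges H" using edges_base[OF fst_column[OF c'(1)]] c'(2) e' by auto
    then show ?thesis using edges_base[OF fst_column[OF c]] by auto
  next
    case False
    then obtain w where w: "w \<in> {u, v}" "w \<notin> verts H" by blast
    then have "emb c w \<in> emb c' ` e'" using c'(3) by auto
    then have "c' = c" using w(2) by (auto simp: embed_copy_def split: if_splits intro: prod_eqI)
    then show ?thesis using c'(2) e' by simp
  qed
qed

lemma clique_emb:
  assumes c: "c \<in> columns s a" and C: "clique (P (fst c)) C"
  shows "clique (glue H s G a) (emb c ` C)"
  unfolding clique_def
proof (intro conjI ballI impI)
  show "emb c ` C \<subseteq> verts (glue H s G a)"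
    using c C unfolding verts_glue clique_def by blast
next
  fix x y assume "x \<in> emb c ` C" "y \<in> emb c ` C" "x \<noteq> y"
  then obtain u v where uv: "u \<in> C" "v \<in> C" "u \<noteq> v" "x = emb c u" "y = emb c v" by blast
  then have "{u, v} \<in> edges (P (fst c))" using C by (auto simp: clique_def)
  then have "emb c ` {u, v} \<in> edges (glue H s G a)" unfolding edges_glue using c by blast
  then show "{x, y} \<in> edges (glue H s G a)" using uv by simp
qed

lemma clique_glueE:
  assumes D: "clique (glue H s G a) D"
  obtains c C where "c \<in> columns s a" "clique (P (fst c)) C" "D = emb c ` C"
proof -
  have "\<exists>c\<in>columns s a. D \<subseteq> emb c ` verts (P (fst c))"
  proof (cases "\<exists>i k j. Copy i k j \<in> D")
    case True
    then obtain i k j where j: "Copy i k j \<in> D" by blast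
    have "Copy i k j \<in> verts (glue H s G a)" using D j by (auto simp: clique_def)
    then obtain c where c: "c \<in> columns s a" "Copy i k j \<in> emb c ` verts (P (fst c))"
      unfolding verts_glue by blast
    then have ik: "fst c = i" "snd c = k" by auto
    have "x \<in> emb c ` verts (P (fst c))" if x: "x \<in> D" for x
    proof (cases "x = Copy i k j")
      case False
      then have "{x, Copy i k j} \<in> edges (glue H s G a)" using D j x by (auto simp: clique_def)
      then obtain c' e' where c': "c' \<in> columns s a" "e' \<in> edges (P (fst c'))" "{x, Copy i k j} = emb c' ` e'"
        unfolding edges_glue by auto
      have "Copy i k j \<in> emb c' ` e'" using c'(3) by blast
      then have "c' = c" using ik by (auto intro: prod_eqI)
      have "x \<in> emb c' ` e'" using c'(3) by blast
      moreover have "e' \<subseteq> verts (P (fst c'))"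
        using simple_piece[OF fst_column[OF c'(1)]] c'(2) by (simp add: simple_graph_def)
      ultimately show ?thesis using \<open>c' = c\<close> by blast
    qed (use c in simp)
    then show ?thesis using c(1) by blast
  next
    case False
    have "x \<in> Shared ` verts H" if x: "x \<in> D" for x
    proof -
      obtain c u where "c \<in> columns s a" "u \<in> verts (P (fst c))" "x = emb c u"
        using D x unfolding clique_def verts_glue by blast
      then show ?thesis using False x by (auto simp: embed_copy_def split: if_splits)
    qed
    then have "D \<subseteq> emb (0, 1) ` verts (P (fst (0, 1)))"
      using emb_base[of "verts H" "(0, 1)"] by (auto simp: piece_def)
    then show ?thesis by (intro bexI[of _ "(0, 1)"]) (auto simp: columns_def)
  qed
  then obtain c where c: "c \<in> columns s a" "D \<subseteq> emb c ` verts (P (fst c))" by blast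
  then obtain C where C: "C \<subseteq> verts (P (fst c))" "D = emb c ` C" by (meson subset_imageE)
  have "clique (P (fst c)) C"
    unfolding clique_def
  proof (intro conjI ballI impI)
    fix u v assume uv: "u \<in> C" "v \<in> C" "u \<noteq> v"
    then have "emb c u \<noteq> emb c v" by (metis label_embed_copy)
    then have "{emb c u, emb c v} \<in> edges (glue H s G a)" using D C(2) uv by (auto simp: clique_def)
    then show "{u, v} \<in> edges (P (fst c))" using edge_glueD[OF c(1)] C(1) uv by blast
  qed (rule C(1))
  then show ?thesis using that c(1) C(2) by blast
qed

definition col :: "('v gnode \<Rightarrow> nat) \<Rightarrow> nat \<times> nat \<Rightarrow> 'v \<Rightarrow> nat" where
  "col \<beta> c = restrict (\<beta> \<circ> emb c) (verts (P (fst c)))"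

abbreviation \<rho> :: "('v \<Rightarrow> nat) \<Rightarrow> 'v \<Rightarrow> nat" where "\<rho> \<sigma> \<equiv> restrict \<sigma> (verts H)"

abbreviation piece_states :: "nat \<Rightarrow> ('v \<Rightarrow> nat) set" where
  "piece_states i \<equiv> states d (verts (P i))"

abbreviation glue_states :: "(nat \<Rightarrow> nat) \<Rightarrow> ('v gnode \<Rightarrow> nat) set" where
  "glue_states a \<equiv> states (d \<circ> label) (verts (glue H s G a))"

definition piece_marginals :: "nat \<Rightarrow> (('v \<Rightarrow> nat) \<Rightarrow> 'v \<Rightarrow> nat) set" where
  "piece_marginals i = (\<lambda>C \<sigma>. restrict \<sigma> C) ` {C. clique (P i) C}"

lemma finite_piece_states: "i \<in> {0..s} \<Longrightarrow> finite (piece_states i)"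
  using simple_piece[of i] unfolding states_def by (intro finite_PiE) (auto simp: simple_graph_def)

lemma column_system:
  "column_system (glue_states a) (columns s a) col fst {0..s} piece_states \<rho> piece_marginals"
proof
  show "finite (columns s a)" by (rule finite_columns)
  show "columns s a \<noteq> {}" by (simp add: columns_def)
  show "fst c \<in> {0..s}" if "c \<in> columns s a" for c using that by (rule fst_column)
  show "piece_marginals i \<noteq> {}" if "i \<in> {0..s}" for i
  proof -
    have "clique (P i) {}" by (simp add: clique_def)
    then show ?thesis by (auto simp: piece_marginals_def)
  qed
  show "col \<beta> c \<in> piece_states (fst c)" if \<beta>: "\<beta> \<in> glue_states a" and c: "c \<in> columns s a" for \<beta> c
  proof -
    have "\<beta> (emb c j) \<in> {1..d j}" if "j \<in> verts (P (fst c))" for j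
    proof -
      have "emb c j \<in> verts (glue H s G a)" using that c unfolding verts_glue by blast
      then show ?thesis using \<beta> unfolding states_def by (auto dest: PiE_mem)
    qed
    then show ?thesis by (auto simp: states_def col_def)
  qed
  show "\<rho> (col \<beta> c) = \<rho> (col \<beta> c')" if "c \<in> columns s a" "c' \<in> columns s a" for \<beta> c c'
  proof
    fix j
    show "\<rho> (col \<beta> c) j = \<rho> (col \<beta> c') j"
      using piece_sub[OF fst_column[OF that(1)]] piece_sub[OF fst_column[OF that(2)]]
      by (auto simp: col_def restrict_def embed_copy_def)
  qed
  show "\<exists>\<beta>\<in>glue_states a. \<forall>c\<in>columns s a. col \<beta> c = \<sigma> c"
    if \<sigma>: "\<And>c. c \<in> columns s a \<Longrightarrow> \<sigma> c \<in> piece_states (fst c) \<and> \<rho> (\<sigma> c) = r" for \<sigma> r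
  proof -
    define b where "b x = (case x of Shared j \<Rightarrow> r j | Copy i k j \<Rightarrow> \<sigma> (i, k) j)" for x
    have b: "b (emb c j) = \<sigma> c j" if "c \<in> columns s a" for c j
    proof (cases "j \<in> verts H")
      case True
      then have "\<rho> (\<sigma> c) j = \<sigma> c j" by simp
      then show ?thesis using \<sigma>[OF that] True by (simp add: b_def embed_copy_def)
    qed (simp add: b_def embed_copy_def)
    define \<beta> where "\<beta> = restrict b (verts (glue H s G a))"
    have "b x \<in> {1..(d \<circ> label) x}" if x: "x \<in> verts (glue H s G a)" for x
    proof -
      obtain c j where c: "c \<in> columns s a" "j \<in> verts (P (fst c))" "x = emb c j"
        using x unfolding verts_glue by blast
      then have "\<sigma> c j \<in> {1..d j}" using \<sigma>[OF c(1)] unfolding states_def by (auto dest: PiE_mem)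
      then show ?thesis using b[OF c(1)] c(3) by simp
    qed
    then have "\<beta> \<in> glue_states a" by (auto simp: \<beta>_def states_def)
    moreover have "col \<beta> c = \<sigma> c" if c: "c \<in> columns s a" for c
    proof
      fix j
      show "col \<beta> c j = \<sigma> c j"
      proof (cases "j \<in> verts (P (fst c))")
        case True
        then have "emb c j \<in> verts (glue H s G a)" using c unfolding verts_glue by blast
        then show ?thesis using True b[OF c] by (simp add: col_def \<beta>_def)
      next
        case False
        then have "\<sigma> c j = undefined" using \<sigma>[OF c] by (auto simp: states_def)
        then show ?thesis using False by (simp add: col_def)
      qed
    qed
    ultimately show ?thesis by blast
  qed
qed

lemma restrict_col:
  assumes "C \<subseteq> verts (P (fst c))" "emb c ` C \<subseteq> D"
  shows "restrict (col \<beta> c) C = restrict (restrict \<beta> D \<circ> emb c) C"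
  using assms by (auto simp: col_def fun_eq_iff restrict_def)

lemma restrict_image_emb:
  assumes "C \<subseteq> verts (P (fst c))"
  shows "restrict \<beta> (emb c ` C) = restrict (restrict (col \<beta> c) C \<circ> label) (emb c ` C)"
  using assms by (auto simp: col_def fun_eq_iff restrict_def)

lemma image_mset_factor:
  assumes "image_mset f M = image_mset f M'" "\<And>x. g x = h (f x)"
  shows "image_mset g M = image_mset g M'"
proof -
  have "image_mset h (image_mset f M) = image_mset h (image_mset f M')" by (simp only: assms(1))
  moreover have "g = h \<circ> f" using assms(2) by auto
  ultimately show ?thesis by (simp add: multiset.map_comp)
qed

lemma equiv_marginals_iff:
  "column_system.equiv_marginals (columns s a) col fst piece_marginals M M' \<longleftrightarrow>
    (\<forall>C\<in>mcl (glue H s G a). image_mset (\<lambda>\<beta>. restrict \<beta> C) M = image_mset (\<lambda>\<beta>. restrict \<beta> C) M')"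
  (is "_ \<longleftrightarrow> ?R")
proof -
  interpret column_system "glue_states a" "columns s a" col fst "{0..s}" piece_states \<rho> piece_marginals
    by (rule column_system)
  have "equiv_marginals M M' \<longleftrightarrow> (\<forall>c\<in>columns s a. \<forall>C. clique (P (fst c)) C \<longrightarrow>
      image_mset (\<lambda>\<beta>. restrict (col \<beta> c) C) M = image_mset (\<lambda>\<beta>. restrict (col \<beta> c) C) M')"
    by (auto simp: equiv_marginals_def same_marginals_def piece_marginals_def colm_def multiset.map_comp comp_def)
  also have "\<dots> \<longleftrightarrow> ?R"
  proof (intro iffI ballI allI impI)
    fix D assume L: "\<forall>c\<in>columns s a. \<forall>C. clique (P (fst c)) C \<longrightarrow>
      image_mset (\<lambda>\<beta>. restrict (col \<beta> c) C) M = image_mset (\<lambda>\<beta>. restrict (col \<beta> c) C) M'"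
      and "D \<in> mcl (glue H s G a)"
    then have "clique (glue H s G a) D" by (simp add: mcl_def)
    then obtain c C where c: "c \<in> columns s a" "clique (P (fst c)) C" "D = emb c ` C"
      by (rule clique_glueE)
    then have "C \<subseteq> verts (P (fst c))" by (simp add: clique_def)
    with c L show "image_mset (\<lambda>\<beta>. restrict \<beta> D) M = image_mset (\<lambda>\<beta>. restrict \<beta> D) M'"
      using image_mset_factor[of "\<lambda>\<beta>. restrict (col \<beta> c) C" M M' "\<lambda>\<beta>. restrict \<beta> D"
          "\<lambda>\<alpha>. restrict (\<alpha> \<circ> label) D"] restrict_image_emb[of C c] by blast
  next
    fix c C assume R: ?R and c: "c \<in> columns s a" "clique (P (fst c)) C"
    obtain D where D: "D \<in> mcl (glue H s G a)" "emb c ` C \<subseteq> D"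
      using clique_extends_to_mcl[OF finite_verts_glue clique_emb[OF c]] .
    have "C \<subseteq> verts (P (fst c))" using c by (simp add: clique_def)
    then show "image_mset (\<lambda>\<beta>. restrict (col \<beta> c) C) M = image_mset (\<lambda>\<beta>. restrict (col \<beta> c) C) M'"
      using image_mset_factor[of "\<lambda>\<beta>. restrict \<beta> D" M M' "\<lambda>\<beta>. restrict (col \<beta> c) C"
          "\<lambda>\<alpha>. restrict (\<alpha> \<circ> emb c) C"] R D restrict_col[of C c D] by blast
  qed
  finally show ?thesis .
qed

end

section \<open>The ideal of a graph as a span of binomials\<close>

lemma characters_independent:
  fixes F :: "('t \<Rightarrow> 'a::field) set"
  assumes "finite F"
    and "\<And>\<chi> x y. \<chi> \<in> F \<Longrightarrow> \<chi> (mul x y) = \<chi> x * \<chi> y" "\<And>\<chi>. \<chi> \<in> F \<Longrightarrow> \<chi> e = 1"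
    and "\<And>x. (\<Sum>\<chi>\<in>F. c \<chi> * \<chi> x) = 0" "\<chi> \<in> F"
  shows "c \<chi> = 0"
  using assms
proof (induction F arbitrary: c \<chi> rule: finite_induct)
  case empty
  then show ?case by simp
next
  case (insert \<psi> F)
  have c0: "c \<chi> = 0" if "\<chi> \<in> F" for \<chi>
  proof -
    have "\<chi> \<noteq> \<psi>" using that insert.hyps by blast
    then obtain y where y: "\<chi> y \<noteq> \<psi> y" by blast
    have "(\<Sum>\<chi>\<in>F. (c \<chi> * (\<chi> y - \<psi> y)) * \<chi> x) = 0" for x
    proof -
      have 1: "c \<psi> * \<psi> (mul y x) + (\<Sum>\<chi>\<in>F. c \<chi> * \<chi> (mul y x)) = 0"
        using insert.prems(3)[of "mul y x"] insert.hyps by simp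
      have 2: "c \<psi> * \<psi> x + (\<Sum>\<chi>\<in>F. c \<chi> * \<chi> x) = 0"
        using insert.prems(3)[of x] insert.hyps by simp
      have "(\<Sum>\<chi>\<in>F. (c \<chi> * (\<chi> y - \<psi> y)) * \<chi> x) = (\<Sum>\<chi>\<in>F. c \<chi> * \<chi> (mul y x)) - \<psi> y * (\<Sum>\<chi>\<in>F. c \<chi> * \<chi> x)"
        unfolding sum_distrib_left sum_subtractf[symmetric]
        by (rule sum.cong) (auto simp: insert.prems(1) algebra_simps)
      also have "(\<Sum>\<chi>\<in>F. c \<chi> * \<chi> (mul y x)) = - (c \<psi> * \<psi> (mul y x))" using 1 by (simp add: eq_neg_iff_add_eq_0 add.commute)
      also have "(\<Sum>\<chi>\<in>F. c \<chi> * \<chi> x) = - (c \<psi> * \<psi> x)" using 2 by (simp add: eq_neg_iff_add_eq_0 add.commute)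
      finally show ?thesis using insert.prems(1)[of \<psi> y x] by (simp add: algebra_simps)
    qed
    then have "c \<chi> * (\<chi> y - \<psi> y) = 0"
      using insert.IH[of "\<lambda>\<chi>. c \<chi> * (\<chi> y - \<psi> y)" \<chi>] insert.prems(1,2) that by blast
    then show ?thesis using y by simp
  qed
  then have "(\<Sum>\<chi>\<in>F. c \<chi> * \<chi> e) = 0" by (intro sum.neutral) simp
  then have "c \<psi> = 0" using insert.prems(3)[of e] insert.prems(2)[of \<psi>] insert.hyps by simp
  then show ?case using c0 insert.prems(4) by blast
qed

definition mset_of_mon :: "('x \<Rightarrow>\<^sub>0 nat) \<Rightarrow> 'x multiset" where
  "mset_of_mon m = Abs_multiset (Poly_Mapping.lookup m)"

definition mon_of_mset :: "'x multiset \<Rightarrow> ('x \<Rightarrow>\<^sub>0 nat)" where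
  "mon_of_mset M = Abs_poly_mapping (count M)"

lemma count_mset_of_mon [simp]: "count (mset_of_mon m) = Poly_Mapping.lookup m"
  unfolding mset_of_mon_def by (rule count_Abs_multiset) (use finite_lookup[of m] in simp)

lemma lookup_mon_of_mset [simp]: "Poly_Mapping.lookup (mon_of_mset M) = count M"
  unfolding mon_of_mset_def by (rule Abs_poly_mapping_inverse) (simp add: count_eq_zero_iff)

lemma mset_of_mon_inverse [simp]: "mon_of_mset (mset_of_mon m) = m"
  by (rule poly_mapping_eqI) simp

lemma mon_of_mset_inverse [simp]: "mset_of_mon (mon_of_mset M) = M"
  by (rule multiset_eqI) simp

lemma mon_of_mset_plus: "mon_of_mset (M + M') = mon_of_mset M + mon_of_mset M'"
  by (rule poly_mapping_eqI) (simp add: lookup_add)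

lemma mset_of_mon_plus: "mset_of_mon (m + n) = mset_of_mon m + mset_of_mon n"
  by (rule multiset_eqI) (simp add: lookup_add)

lemma set_mset_of_mon [simp]: "set_mset (mset_of_mon m) = Poly_Mapping.keys m"
  by (rule Set.set_eqI) (simp add: in_keys_iff flip: count_greater_zero_iff)

lemma keys_mon_of_mset [simp]: "Poly_Mapping.keys (mon_of_mset M) = set_mset M"
  by (rule set_mset_of_mon[of "mon_of_mset M", unfolded mon_of_mset_inverse, symmetric])

lemma poly_eq_sum_single: "p = (\<Sum>m\<in>Poly_Mapping.keys p. Poly_Mapping.single m (Poly_Mapping.lookup p m))"
proof (rule poly_mapping_eqI)
  fix k
  show "Poly_Mapping.lookup p k = Poly_Mapping.lookup (\<Sum>m\<in>Poly_Mapping.keys p. Poly_Mapping.single m (Poly_Mapping.lookup p m)) k"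
  proof (cases "k \<in> Poly_Mapping.keys p")
    case True
    then show ?thesis by (simp add: lookup_sum lookup_single when_def)
  next
    case False
    then show ?thesis by (simp add: lookup_sum lookup_single when_def not_in_keys_iff_lookup_eq_zero)
  qed
qed

lemma eval_poly_superset:
  assumes "finite A" "Poly_Mapping.keys p \<subseteq> A"
  shows "eval_poly x p = (\<Sum>m\<in>A. Poly_Mapping.lookup p m * prod_mset (image_mset x (mset_of_mon m)))"
proof -
  have "eval_poly x p = (\<Sum>m\<in>Poly_Mapping.keys p. Poly_Mapping.lookup p m * prod_mset (image_mset x (mset_of_mon m)))"
    by (simp add: eval_poly_def image_prod_mset_multiplicity)
  also have "\<dots> = (\<Sum>m\<in>A. Poly_Mapping.lookup p m * prod_mset (image_mset x (mset_of_mon m)))"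
    by (rule sum.mono_neutral_left) (use assms in \<open>auto simp: in_keys_iff\<close>)
  finally show ?thesis .
qed

lemma eval_poly_single: "eval_poly x (Poly_Mapping.single m c) = c * prod_mset (image_mset x (mset_of_mon m))"
  by (subst eval_poly_superset[of "{m}"]) auto

lemma eval_poly_add: "eval_poly x (p + q) = eval_poly x p + eval_poly x q"
proof -
  let ?A = "Poly_Mapping.keys p \<union> Poly_Mapping.keys q"
  have "eval_poly x r = (\<Sum>m\<in>?A. Poly_Mapping.lookup r m * prod_mset (image_mset x (mset_of_mon m)))"
    if "Poly_Mapping.keys r \<subseteq> ?A" for r
    by (rule eval_poly_superset) (use that in auto)
  then show ?thesis
    using Poly_Mapping.keys_add[of p q] by (simp add: lookup_add algebra_simps sum.distrib)
qed

lemma eval_poly_0 [simp]: "eval_poly x 0 = 0"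
  by (simp add: eval_poly_def)

lemma eval_poly_sum: "eval_poly x (\<Sum>i\<in>A. f i) = (\<Sum>i\<in>A. eval_poly x (f i))"
  by (induction A rule: infinite_finite_induct) (auto simp: eval_poly_add)

lemma eval_poly_mult: "eval_poly x (p * q) = eval_poly x p * eval_poly x q"
proof -
  have "p * q = (\<Sum>m\<in>Poly_Mapping.keys p. \<Sum>n\<in>Poly_Mapping.keys q.
      Poly_Mapping.single (m + n) (Poly_Mapping.lookup p m * Poly_Mapping.lookup q n))"
    by (subst arg_cong2[where f = "(*)", OF poly_eq_sum_single[of p] poly_eq_sum_single[of q]])
       (simp add: sum_product mult_single)
  moreover have "eval_poly x p = (\<Sum>m\<in>Poly_Mapping.keys p. Poly_Mapping.lookup p m * prod_mset (image_mset x (mset_of_mon m)))" for p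
    by (rule eval_poly_superset) auto
  ultimately show ?thesis
    by (simp add: eval_poly_sum eval_poly_single mset_of_mon_plus sum_product algebra_simps)
qed

lemma poly_ring_simps [simp]:
  "carrier (poly_ring X) = {p. indets p \<subseteq> X}" "p \<otimes>\<^bsub>poly_ring X\<^esub> q = p * q"
  "p \<oplus>\<^bsub>poly_ring X\<^esub> q = p + q" "\<zero>\<^bsub>poly_ring X\<^esub> = 0" "\<one>\<^bsub>poly_ring X\<^esub> = 1"
  by (auto simp: poly_ring_def)

lemma indets_uminus [simp]: "indets (- p) = indets p"
  by (simp add: indets_def)

lemma indets_diff: "indets (p - q) \<subseteq> indets p \<union> indets q"
  using keys_diff[of p q] by (auto simp: indets_def)

lemma indets_single: "indets (Poly_Mapping.single m c) \<subseteq> Poly_Mapping.keys m"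
  by (auto simp: indets_def)

lemma a_inv_poly_ring:
  assumes "indets p \<subseteq> X" shows "\<ominus>\<^bsub>poly_ring X\<^esub> p = - p"
proof -
  interpret cring "poly_ring X" by (rule poly_ring_cring)
  show ?thesis by (rule minus_equality) (use assms in auto)
qed

lemma ideal_graph_ideal: "ideal (graph_ideal G d) (graph_poly_ring G d)"
proof -
  let ?S = "states d (verts G)"
  interpret cring "poly_ring ?S" by (rule poly_ring_cring)
  have neg: "eval_poly x (- p) = - eval_poly x p" for x p
    using eval_poly_add[of x p "- p"] by (simp add: eq_neg_iff_add_eq_0 add.commute)
  show ?thesis
    unfolding graph_poly_ring_def
  proof (rule idealI)
    show "ring (poly_ring ?S)" by (rule ring_axioms)
    show "subgroup (graph_ideal G d) (add_monoid (poly_ring ?S))"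
    proof
      fix p q assume "p \<in> graph_ideal G d" "q \<in> graph_ideal G d"
      then show "p \<otimes>\<^bsub>add_monoid (poly_ring ?S)\<^esub> q \<in> graph_ideal G d"
        using a_closed[of p q] by (auto simp: graph_ideal_def graph_poly_ring_def eval_poly_add)
    next
      fix p assume "p \<in> graph_ideal G d"
      then show "inv\<^bsub>add_monoid (poly_ring ?S)\<^esub> p \<in> graph_ideal G d"
        using a_inv_poly_ring[of p ?S]
        by (auto simp: graph_ideal_def graph_poly_ring_def neg a_inv_def)
    qed (auto simp: graph_ideal_def graph_poly_ring_def indets_def)
  next
    fix p q assume "p \<in> graph_ideal G d" "q \<in> carrier (poly_ring ?S)"
    then show "q \<otimes>\<^bsub>poly_ring ?S\<^esub> p \<in> graph_ideal G d" "p \<otimes>\<^bsub>poly_ring ?S\<^esub> q \<in> graph_ideal G d"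
      using m_closed[of p q] m_closed[of q p]
      by (auto simp: graph_ideal_def graph_poly_ring_def eval_poly_mult)
  qed
qed

definition clique_value :: "'v ugraph \<Rightarrow> ('v \<Rightarrow> nat) multiset \<Rightarrow> ('v set \<times> ('v \<Rightarrow> nat) \<Rightarrow> complex) \<Rightarrow> complex" where
  "clique_value G M \<theta> = (\<Prod>\<beta>\<in>#M. \<Prod>C\<in>mcl G. \<theta> (C, restrict \<beta> C))"

lemma clique_value_mult:
  "clique_value G M (\<lambda>i. \<theta> i * \<theta>' i) = clique_value G M \<theta> * clique_value G M \<theta>'"
  by (simp add: clique_value_def prod.distrib prod_mset.distrib)

lemma clique_value_one: "clique_value G M (\<lambda>i. 1) = 1"
  by (simp add: clique_value_def)

lemma clique_value_cliques:
  "clique_value G M \<theta> = (\<Prod>C\<in>mcl G. \<Prod>\<alpha>\<in>#image_mset (\<lambda>\<beta>. restrict \<beta> C) M. \<theta> (C, \<alpha>))"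
  unfolding clique_value_def by (induction M) (auto simp: prod.distrib)

lemma clique_value_eq_iff:
  assumes "finite (mcl G)"
  shows "clique_value G M = clique_value G M' \<longleftrightarrow>
    (\<forall>C\<in>mcl G. image_mset (\<lambda>\<beta>. restrict \<beta> C) M = image_mset (\<lambda>\<beta>. restrict \<beta> C) M')"
proof
  assume eq: "clique_value G M = clique_value G M'"
  show "\<forall>C\<in>mcl G. image_mset (\<lambda>\<beta>. restrict \<beta> C) M = image_mset (\<lambda>\<beta>. restrict \<beta> C) M'"
  proof (intro ballI multiset_eqI)
    fix C \<alpha> assume C: "C \<in> mcl G"
    define \<theta> :: "'a set \<times> ('a \<Rightarrow> nat) \<Rightarrow> complex" where "\<theta> j = (if j = (C, \<alpha>) then 2 else 1)" for j
    have 1: "(\<Prod>\<gamma>\<in>#U. \<theta> (C', \<gamma>)) = (if C' = C then 2 ^ count U \<alpha> else 1)" for U C'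
      by (induction U) (auto simp: \<theta>_def)
    have 2: "clique_value G M \<theta> = 2 ^ count (image_mset (\<lambda>\<beta>. restrict \<beta> C) M) \<alpha>" for M
      unfolding clique_value_cliques 1 using assms C by (simp add: prod.delta')
    have "(2::complex) ^ count (image_mset (\<lambda>\<beta>. restrict \<beta> C) M) \<alpha> = 2 ^ count (image_mset (\<lambda>\<beta>. restrict \<beta> C) M') \<alpha>"
      using 2[of M] 2[of M'] eq by simp
    then have "of_nat (2 ^ count (image_mset (\<lambda>\<beta>. restrict \<beta> C) M) \<alpha>) =
        (of_nat (2 ^ count (image_mset (\<lambda>\<beta>. restrict \<beta> C) M') \<alpha>) :: complex)"
      by (simp only: of_nat_power of_nat_numeral)
    then have "(2::nat) ^ count (image_mset (\<lambda>\<beta>. restrict \<beta> C) M) \<alpha> = 2 ^ count (image_mset (\<lambda>\<beta>. restrict \<beta> C) M') \<alpha>"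
      by (simp only: of_nat_eq_iff)
    then show "count (image_mset (\<lambda>\<beta>. restrict \<beta> C) M) \<alpha> = count (image_mset (\<lambda>\<beta>. restrict \<beta> C) M') \<alpha>"
      by (simp add: power_inject_exp)
  qed
qed (auto simp: clique_value_cliques fun_eq_iff)

lemma param_space_eq_restrict:
  "param_space G d = range (\<lambda>\<theta>. restrict \<theta> (SIGMA C:mcl G. states d C))"
proof
  show "param_space G d \<subseteq> range (\<lambda>\<theta>. restrict \<theta> (SIGMA C:mcl G. states d C))"
  proof
    fix \<theta> assume "\<theta> \<in> param_space G d"
    then have "\<theta> = restrict \<theta> (SIGMA C:mcl G. states d C)" by (simp add: param_space_def PiE_restrict)
    then show "\<theta> \<in> range (\<lambda>\<theta>. restrict \<theta> (SIGMA C:mcl G. states d C))"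
      by (rule range_eqI[of \<theta> "\<lambda>\<theta>. restrict \<theta> (SIGMA C:mcl G. states d C)" \<theta>])
  qed
  show "range (\<lambda>\<theta>. restrict \<theta> (SIGMA C:mcl G. states d C)) \<subseteq> param_space G d"
    unfolding param_space_def by (rule image_subsetI, rule PiE_I) (simp_all add: restrict_def)
qed

lemma prod_mset_param_map:
  assumes "set_mset M \<subseteq> states d (verts G)"
  shows "(\<Prod>\<beta>\<in>#M. param_map G d (restrict \<theta> (SIGMA C:mcl G. states d C)) \<beta>) = clique_value G M \<theta>"
  unfolding clique_value_def
proof (rule arg_cong[where f = prod_mset], rule image_mset_cong)
  fix \<beta> assume "\<beta> \<in># M"
  then have \<beta>: "\<beta> \<in> states d (verts G)" using assms by blast
  have "(C, restrict \<beta> C) \<in> (SIGMA C:mcl G. states d C)" if "C \<in> mcl G" for C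
    using that \<beta> by (auto simp: states_def mcl_def clique_def PiE_def Pi_def)
  then show "param_map G d (restrict \<theta> (SIGMA C:mcl G. states d C)) \<beta> = (\<Prod>C\<in>mcl G. \<theta> (C, restrict \<beta> C))"
    using \<beta> by (simp add: param_map_def)
qed

lemma mem_graph_ideal_iff:
  "p \<in> graph_ideal G d \<longleftrightarrow> indets p \<subseteq> states d (verts G) \<and>
    (\<forall>\<theta>. (\<Sum>m\<in>Poly_Mapping.keys p. Poly_Mapping.lookup p m * clique_value G (mset_of_mon m) \<theta>) = 0)"
proof -
  have "eval_poly (param_map G d (restrict \<theta> (SIGMA C:mcl G. states d C))) p =
      (\<Sum>m\<in>Poly_Mapping.keys p. Poly_Mapping.lookup p m * clique_value G (mset_of_mon m) \<theta>)"
    if p: "indets p \<subseteq> states d (verts G)" for \<theta>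
    unfolding eval_poly_superset[OF finite_keys order_refl]
  proof (rule sum.cong[OF refl])
    fix m assume "m \<in> Poly_Mapping.keys p"
    then have "set_mset (mset_of_mon m) \<subseteq> states d (verts G)" using p by (auto simp: indets_def)
    from prod_mset_param_map[OF this]
    show "Poly_Mapping.lookup p m * (\<Prod>\<beta>\<in>#mset_of_mon m. param_map G d (restrict \<theta> (SIGMA C:mcl G. states d C)) \<beta>) =
        Poly_Mapping.lookup p m * clique_value G (mset_of_mon m) \<theta>" by simp
  qed
  then show ?thesis
    unfolding graph_ideal_def graph_poly_ring_def param_space_eq_restrict by auto
qed

lemma binomial_in_graph_ideal:
  assumes "Poly_Mapping.keys m \<subseteq> states d (verts G)" "Poly_Mapping.keys m' \<subseteq> states d (verts G)"
    and eq: "clique_value G (mset_of_mon m) = clique_value G (mset_of_mon m')"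
  shows "Poly_Mapping.single m 1 - Poly_Mapping.single m' 1 \<in> graph_ideal G d"
proof -
  let ?b = "Poly_Mapping.single m 1 - Poly_Mapping.single m' (1::complex)"
  have "indets ?b \<subseteq> states d (verts G)"
    using indets_diff[of "Poly_Mapping.single m 1" "Poly_Mapping.single m' (1::complex)"]
      indets_single[of m "1::complex"] indets_single[of m' "1::complex"] assms(1,2) by blast
  moreover have "eval_poly x ?b = 0" if x: "x \<in> param_map G d ` param_space G d" for x
  proof -
    obtain \<theta> where \<theta>: "x = param_map G d (restrict \<theta> (SIGMA C:mcl G. states d C))"
      using x unfolding param_space_eq_restrict by blast
    have "(\<Prod>\<beta>\<in>#mset_of_mon m. x \<beta>) = (\<Prod>\<beta>\<in>#mset_of_mon m'. x \<beta>)"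
      unfolding \<theta> using assms by (simp add: prod_mset_param_map)
    moreover have "eval_poly x ?b + eval_poly x (Poly_Mapping.single m' 1) = eval_poly x (Poly_Mapping.single m 1)"
      by (simp flip: eval_poly_add)
    ultimately show ?thesis by (simp add: eval_poly_single)
  qed
  ultimately show ?thesis by (simp add: graph_ideal_def graph_poly_ring_def)
qed

lemma single_sum: "Poly_Mapping.single k (\<Sum>i\<in>A. f i) = (\<Sum>i\<in>A. Poly_Mapping.single k (f i))"
  by (induction A rule: infinite_finite_induct) (auto simp: single_add)

lemma graph_ideal_subset_ideal:
  assumes J: "ideal J (graph_poly_ring G d)"
    and bin: "\<And>m m'. Poly_Mapping.keys m \<subseteq> states d (verts G) \<Longrightarrow> Poly_Mapping.keys m' \<subseteq> states d (verts G) \<Longrightarrow>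
      clique_value G (mset_of_mon m) = clique_value G (mset_of_mon m') \<Longrightarrow>
      Poly_Mapping.single m 1 - Poly_Mapping.single m' 1 \<in> J"
  shows "graph_ideal G d \<subseteq> J"
proof
  fix p assume "p \<in> graph_ideal G d"
  then have ind: "indets p \<subseteq> states d (verts G)"
    and zero: "\<And>\<theta>. (\<Sum>m\<in>Poly_Mapping.keys p. Poly_Mapping.lookup p m * clique_value G (mset_of_mon m) \<theta>) = 0"
    by (auto simp: mem_graph_ideal_iff)
  interpret J: ideal J "poly_ring (states d (verts G))" using J by (simp add: graph_poly_ring_def)
  define K where "K = Poly_Mapping.keys p"
  define \<chi> where "\<chi> m = clique_value G (mset_of_mon m)" for m
  define rep where "rep f = (SOME m. m \<in> K \<and> \<chi> m = f)" for f
  define c where "c f = (\<Sum>m\<in>{m \<in> K. \<chi> m = f}. Poly_Mapping.lookup p m)" for f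
  have K: "finite K" by (simp add: K_def)
  have rep: "rep (\<chi> m) \<in> K \<and> \<chi> (rep (\<chi> m)) = \<chi> m" if "m \<in> K" for m
    unfolding rep_def by (rule someI[of _ m]) (use that in simp)
  have keysS: "Poly_Mapping.keys m \<subseteq> states d (verts G)" if "m \<in> K" for m
    using ind that by (auto simp: indets_def K_def)
  have "c f = 0" if "f \<in> \<chi> ` K" for f
  proof (rule characters_independent[of "\<chi> ` K" "\<lambda>\<theta> \<theta>' i. \<theta> i * \<theta>' i" "\<lambda>i. 1" c f])
    fix \<theta>
    have "0 = (\<Sum>m\<in>K. Poly_Mapping.lookup p m * \<chi> m \<theta>)" unfolding K_def \<chi>_def by (rule zero[symmetric])
    also have "\<dots> = (\<Sum>f\<in>\<chi> ` K. \<Sum>m\<in>{m \<in> K. \<chi> m = f}. Poly_Mapping.lookup p m * \<chi> m \<theta>)"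
      by (rule sum.image_gen[OF K])
    also have "\<dots> = (\<Sum>f\<in>\<chi> ` K. c f * f \<theta>)"
      by (rule sum.cong) (auto simp: c_def sum_distrib_right intro!: sum.cong)
    finally show "(\<Sum>f\<in>\<chi> ` K. c f * f \<theta>) = 0" by simp
  qed (use K that in \<open>auto simp: \<chi>_def clique_value_mult clique_value_one\<close>)
  then have "(\<Sum>f\<in>\<chi> ` K. Poly_Mapping.single (rep f) (c f)) = 0"
    by (intro sum.neutral) simp
  moreover have "(\<Sum>m\<in>K. Poly_Mapping.single (rep (\<chi> m)) (Poly_Mapping.lookup p m)) =
      (\<Sum>f\<in>\<chi> ` K. Poly_Mapping.single (rep f) (c f))"
    unfolding c_def single_sum by (subst sum.image_gen[OF K, where g = \<chi>]) (auto intro!: sum.cong)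
  moreover have "p = (\<Sum>m\<in>K. Poly_Mapping.single m (Poly_Mapping.lookup p m))"
    unfolding K_def by (rule poly_eq_sum_single)
  ultimately have "p = (\<Sum>m\<in>K. Poly_Mapping.single m (Poly_Mapping.lookup p m)) -
      (\<Sum>m\<in>K. Poly_Mapping.single (rep (\<chi> m)) (Poly_Mapping.lookup p m))"
    by (simp only: diff_zero)
  also have "\<dots> = (\<Sum>m\<in>K. Poly_Mapping.single 0 (Poly_Mapping.lookup p m) *
      (Poly_Mapping.single m 1 - Poly_Mapping.single (rep (\<chi> m)) 1))"
    by (simp add: sum_subtractf right_diff_distrib mult_single)
  also have "\<dots> \<in> J"
  proof -
    have term_in: "Poly_Mapping.single 0 (Poly_Mapping.lookup p m) *
      (Poly_Mapping.single m 1 - Poly_Mapping.single (rep (\<chi> m)) 1) \<in> J" if m: "m \<in> K" for m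
    proof -
      have "Poly_Mapping.single m 1 - Poly_Mapping.single (rep (\<chi> m)) 1 \<in> J"
        by (rule bin) (use rep[OF m] keysS m in \<open>auto simp: \<chi>_def\<close>)
      moreover have "Poly_Mapping.single 0 (Poly_Mapping.lookup p m) \<in> carrier (poly_ring (states d (verts G)))"
        using indets_single[of 0 "Poly_Mapping.lookup p m"] by auto
      ultimately show ?thesis
        using J.I_l_closed by (metis poly_ring_simps(2))
    qed
    have "(\<Sum>m\<in>A. Poly_Mapping.single 0 (Poly_Mapping.lookup p m) *
      (Poly_Mapping.single m 1 - Poly_Mapping.single (rep (\<chi> m)) 1)) \<in> J" if "finite A" "A \<subseteq> K" for A
      using that
    proof (induction A rule: finite_induct)
      case empty
      then show ?case using additive_subgroup.zero_closed[OF J.additive_subgroup_axioms] by simp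
    next
      case (insert m A)
      then show ?case using additive_subgroup.a_closed[OF J.additive_subgroup_axioms term_in[of m]] by simp
    qed
    then show ?thesis using K by blast
  qed
  finally show "p \<in> J" .
qed

lemma total_degree_binomial_le:
  assumes "size (mset_of_mon m) \<le> D" "size (mset_of_mon n) \<le> D"
  shows "total_degree (Poly_Mapping.single m 1 - Poly_Mapping.single n (1::complex)) \<le> D"
proof -
  have deg: "(\<Sum>i\<in>Poly_Mapping.keys m. Poly_Mapping.lookup m i) = size (mset_of_mon m)" for m :: "'a \<Rightarrow>\<^sub>0 nat"
    by (simp add: size_multiset_overloaded_eq)
  have "Poly_Mapping.keys (Poly_Mapping.single m 1 - Poly_Mapping.single n (1::complex)) \<subseteq> {m, n}"
    using keys_diff[of "Poly_Mapping.single m 1" "Poly_Mapping.single n (1::complex)"] by auto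
  then show ?thesis
    unfolding total_degree_def deg using assms by (subst Max_le_iff) auto
qed

section \<open>Bounded generation\<close>

context glueing
begin

theorem bounded_binomial_generators:
  "\<exists>D. \<forall>a. \<exists>B \<subseteq> carrier (graph_poly_ring (glue H s G a) (d \<circ> label)).
      (\<forall>b\<in>B. is_binomial b \<and> total_degree b \<le> D) \<and>
      graph_ideal (glue H s G a) (d \<circ> label) =
        Idl\<^bsub>graph_poly_ring (glue H s G a) (d \<circ> label)\<^esub> B"
proof -
  obtain D0 where D0: "\<And>n W. profile_of_size \<rho> {0..s} piece_states piece_marginals n W \<Longrightarrow> n > D0 \<Longrightarrow>
    \<exists>n0 W0. profile_of_size \<rho> {0..s} piece_states piece_marginals n0 W0 \<and> 0 < n0 \<and> n0 < n \<and> dominated W0 W"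
    using bounded_indecomposable_profiles[of "{0..s}" piece_states \<rho> piece_marginals] finite_piece_states
    by blast
  define D where "D = max 2 D0"
  show ?thesis
  proof (intro exI[of _ D] allI)
    fix a
    let ?G = "glue H s G a" and ?d = "d \<circ> label"
    let ?S = "glue_states a" and ?R = "graph_poly_ring (glue H s G a) (d \<circ> label)"
    let ?bin = "\<lambda>m m'. Poly_Mapping.single m 1 - Poly_Mapping.single m' (1::complex)"
    define B where "B = {?bin m m' | m m'. Poly_Mapping.keys m \<subseteq> ?S \<and> Poly_Mapping.keys m' \<subseteq> ?S \<and>
      clique_value ?G (mset_of_mon m) = clique_value ?G (mset_of_mon m') \<and>
      size (mset_of_mon m) \<le> D \<and> size (mset_of_mon m') \<le> D}"
    define J where "J = Idl\<^bsub>?R\<^esub> B"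
    have R: "?R = poly_ring ?S" by (simp add: graph_poly_ring_def)
    interpret R: cring ?R unfolding R by (rule poly_ring_cring)
    have indets_bin: "indets (?bin m m') \<subseteq> ?S" if "Poly_Mapping.keys m \<subseteq> ?S" "Poly_Mapping.keys m' \<subseteq> ?S" for m m'
      using indets_diff[of "Poly_Mapping.single m 1" "Poly_Mapping.single m' (1::complex)"]
        indets_single[of m "1::complex"] indets_single[of m' "1::complex"] that by blast
    have B: "B \<subseteq> carrier ?R" unfolding B_def R using indets_bin by auto
    have J: "ideal J ?R" unfolding J_def by (rule R.genideal_ideal[OF B])
    interpret J: ideal J ?R by (rule J)
    have B_sub: "B \<subseteq> J" unfolding J_def by (rule R.genideal_self[OF B])
    have cs: "column_system ?S (columns s a) col fst {0..s} piece_states \<rho> piece_marginals"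
      by (rule column_system)
    interpret cs: column_system ?S "columns s a" col fst "{0..s}" piece_states \<rho> piece_marginals
      by (rule cs)
    have equiv: "cs.equiv_marginals M M' \<longleftrightarrow> clique_value ?G M = clique_value ?G M'" for M M'
      unfolding equiv_marginals_iff clique_value_eq_iff[OF finite_mcl[OF finite_verts_glue]] ..
    define conn where "conn M M' \<longleftrightarrow> ?bin (mon_of_mset M) (mon_of_mset M') \<in> J" for M M'
    interpret cc: column_congruence ?S "columns s a" col fst "{0..s}" piece_states \<rho> piece_marginals conn D
    proof
      fix M M' assume "conn M M'"
      then have J1: "?bin (mon_of_mset M) (mon_of_mset M') \<in> J" by (simp add: conn_def)
      then have "\<ominus>\<^bsub>?R\<^esub> ?bin (mon_of_mset M) (mon_of_mset M') \<in> J" by (rule J.a_inv_closed)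
      moreover have "indets (?bin (mon_of_mset M) (mon_of_mset M')) \<subseteq> ?S"
        using J.Icarr[OF J1] by (simp add: R)
      ultimately show "conn M' M" by (simp add: conn_def R a_inv_poly_ring)
    next
      fix M M' M'' assume "conn M M'" "conn M' M''"
      then have "?bin (mon_of_mset M) (mon_of_mset M') \<oplus>\<^bsub>?R\<^esub> ?bin (mon_of_mset M') (mon_of_mset M'') \<in> J"
        unfolding conn_def by (rule J.a_closed)
      then show "conn M M''" by (simp add: conn_def R)
    next
      fix M M' and L :: "('v gnode \<Rightarrow> nat) multiset" assume "conn M M'" and L: "set_mset L \<subseteq> ?S"
      have "Poly_Mapping.single (mon_of_mset L) 1 \<in> carrier ?R"
        using indets_single[of "mon_of_mset L" "1::complex"] L by (auto simp: R)
      then have "Poly_Mapping.single (mon_of_mset L) 1 \<otimes>\<^bsub>?R\<^esub> ?bin (mon_of_mset M) (mon_of_mset M') \<in> J"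
        using \<open>conn M M'\<close> J.I_l_closed by (simp add: conn_def)
      then show "conn (L + M) (L + M')"
        by (simp add: conn_def R right_diff_distrib mult_single mon_of_mset_plus)
    next
      fix M M' assume *: "set_mset M \<subseteq> ?S" "set_mset M' \<subseteq> ?S" "cs.equiv_marginals M M'" "size M \<le> D"
      then have "?bin (mon_of_mset M) (mon_of_mset M') \<in> B"
        using cs.equiv_marginals_size[OF *(3)] unfolding B_def equiv
        by (intro CollectI exI[of _ "mon_of_mset M"] exI[of _ "mon_of_mset M'"]) simp
      then show "conn M M'" using B_sub by (auto simp: conn_def)
    qed (simp add: D_def)
    have conn: "conn M M'" if "set_mset M \<subseteq> ?S" "set_mset M' \<subseteq> ?S" "cs.equiv_marginals M M'" for M M'
    proof (rule cc.equiv_marginals_imp_R[OF _ that])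
      fix n and W :: "(nat, 'v \<Rightarrow> nat) profile"
      assume "profile_of_size \<rho> {0..s} piece_states piece_marginals n W" "D < n"
      then show "\<exists>n0 W0. profile_of_size \<rho> {0..s} piece_states piece_marginals n0 W0 \<and> 0 < n0 \<and> n0 < n \<and> dominated W0 W"
        by (intro D0) (simp_all add: D_def)
    qed
    have "graph_ideal ?G ?d \<subseteq> J"
    proof (rule graph_ideal_subset_ideal[OF J])
      fix m m' assume "Poly_Mapping.keys m \<subseteq> ?S" "Poly_Mapping.keys m' \<subseteq> ?S"
        "clique_value ?G (mset_of_mon m) = clique_value ?G (mset_of_mon m')"
      then have "conn (mset_of_mon m) (mset_of_mon m')" by (intro conn) (simp_all add: equiv)
      then show "?bin m m' \<in> J" by (simp add: conn_def)
    qed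
    moreover have "J \<subseteq> graph_ideal ?G ?d"
      unfolding J_def
    proof (rule R.genideal_minimal[OF ideal_graph_ideal])
      show "B \<subseteq> graph_ideal ?G ?d"
      proof
        fix b assume "b \<in> B"
        then obtain m m' where b: "b = ?bin m m'" "Poly_Mapping.keys m \<subseteq> ?S" "Poly_Mapping.keys m' \<subseteq> ?S"
          and cv: "clique_value ?G (mset_of_mon m) = clique_value ?G (mset_of_mon m')"
          unfolding B_def by blast
        show "b \<in> graph_ideal ?G ?d" unfolding b(1) by (rule binomial_in_graph_ideal[OF b(2,3) cv])
      qed
    qed
    ultimately have "graph_ideal ?G ?d = Idl\<^bsub>?R\<^esub> B" by (simp add: J_def)
    moreover have "is_binomial b \<and> total_degree b \<le> D" if "b \<in> B" for b
      using that total_degree_binomial_le unfolding B_def is_binomial_def by blast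
    ultimately show "\<exists>B\<subseteq>carrier ?R. (\<forall>b\<in>B. is_binomial b \<and> total_degree b \<le> D) \<and> graph_ideal ?G ?d = Idl\<^bsub>?R\<^esub> B"
      using B by blast
  qed
qed

end

theorem theorem1p1:
  fixes s :: nat
    and G :: "nat \<Rightarrow> 'v ugraph"
    and H :: "'v ugraph"
    and N0 :: "'v set"
    and d :: "'v \<Rightarrow> nat"
  assumes "\<And>i. i \<in> {1..s} \<Longrightarrow> simple_graph (G i)"
    and "simple_graph H" and "verts H = N0"
    and "\<And>i. i \<in> {1..s} \<Longrightarrow> N0 \<subseteq> verts (G i)"
    and "\<And>i k. i \<in> {1..s} \<Longrightarrow> k \<in> {1..s} \<Longrightarrow> i \<noteq> k \<Longrightarrow> verts (G i) \<inter> verts (G k) = N0"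
    and "\<And>i. i \<in> {1..s} \<Longrightarrow> induced_subgraph (G i) N0 = H"
    and "\<And>j. j \<in> N0 \<union> (\<Union>i\<in>{1..s}. verts (G i)) \<Longrightarrow> d j > 0"
  shows "\<exists>D::nat. \<forall>a::nat \<Rightarrow> nat.
    \<exists>B \<subseteq> carrier (graph_poly_ring (glue H s G a) (d \<circ> label)).
      (\<forall>b\<in>B. is_binomial b \<and> total_degree b \<le> D) \<and>
      graph_ideal (glue H s G a) (d \<circ> label) =
        Idl\<^bsub>graph_poly_ring (glue H s G a) (d \<circ> label)\<^esub> B"
proof -
  interpret glueing s G H d
    by standard (use assms(1,2,4,6) in \<open>simp_all add: assms(3)\<close>)
  show ?thesis by (rule bounded_binomial_generators)
qed

end
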